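(* Let $n=1$, so $\mathfrak g=\mathrm{Der}(\mathbb C[t_1])$, and let $V$ be a nontrivial simple smooth $\mathfrak g$-module with height $\ell_V=1$. Then the $\mathfrak g_{\ge0}$-module $V^{(\ell_V)}$ is nontrivial and $1$-dimensional, and $$V\cong \mathrm{Ind}_{\mathfrak g_{\ge0}}^{\mathfrak g}V^{(\ell_V)}$$ as $\mathfrak g$-modules.
   Context: All vector spaces are over $\mathbb C$; $\mathbb Z_+$ denotes the non-negative integers. With $\partial_1=d/dt_1$, $\mathfrak g=\bigoplus_{k\ge-1}\mathfrak g_k$ with $\mathfrak g_k=\mathbb C\,t_1^{k+1}\partial_1$, and $\mathfrak g_{\ge r}=\bigoplus_{k\ge r}\mathfrak g_k$. A $\mathfrak g$-module $V$ is smooth if for every $v\in V$ there is $m\in\mathbb Z_+$ with $\mathfrak g_i v=0$ for all $i\ge m$. For a smooth module $V$ and $r\in\mathbb Z_+$ put $V^{(r)}=\{v\in V\mid \mathfrak g_{\ge r}v=0\}$, which is a $\mathfrak g_{\ge0}$-submodule of $V$; the height of $V$ is $\ell_V=\min\{r\in\mathbb Z_+\mid V^{(r)}\ne0\}$. A module is trivial if the Lie algebra acts by zero, and nontrivial otherwise. $\mathrm{Ind}_{\mathfrak g_{\ge0}}^{\mathfrak g}E=U(\mathfrak g)\otimes_{U(\mathfrak g_{\ge0})}E$ is the induced module. *)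

theory Defs
  imports
    "HOL-Algebra.QuotRing"
    "HOL-Algebra.Generated_Groups"
    "HOL-Algebra.Free_Abelian_Groups"
    "Jordan_Normal_Form.VS_Connect"
begin

section \<open>Lie algebras and their modules\<close>

text \<open>
  Vector spaces over \<open>\<complex>\<close> are records of type \<open>(complex, _) module\<close> over the base field
  \<^term>\<open>class_ring :: complex ring\<close>.  A Lie algebra is such a record whose \<open>mult\<close> field is the
  bracket, so that \<open>x \<otimes>\<^bsub>L\<^esub> y\<close> is to be read as \<open>[x, y]\<close>; its \<open>one\<close> field is meaningless.
  The \<open>mult\<close> and \<open>one\<close> fields of a module are meaningless as well.
\<close>

locale lie_algebra = vectorspace "class_ring :: complex ring" L
  for L :: "(complex, 'g) module" (structure) +
  assumes bracket_closed: "\<lbrakk>x \<in> carrier L; y \<in> carrier L\<rbrakk> \<Longrightarrow> x \<otimes> y \<in> carrier L"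
    and bracket_add_left: "\<lbrakk>x \<in> carrier L; y \<in> carrier L; z \<in> carrier L\<rbrakk> \<Longrightarrow>
          (x \<oplus> y) \<otimes> z = (x \<otimes> z) \<oplus> (y \<otimes> z)"
    and bracket_smult_left: "\<lbrakk>x \<in> carrier L; y \<in> carrier L\<rbrakk> \<Longrightarrow>
          (c \<odot>\<^bsub>L\<^esub> x) \<otimes> y = c \<odot>\<^bsub>L\<^esub> (x \<otimes> y)"
    and bracket_add_right: "\<lbrakk>x \<in> carrier L; y \<in> carrier L; z \<in> carrier L\<rbrakk> \<Longrightarrow>
          x \<otimes> (y \<oplus> z) = (x \<otimes> y) \<oplus> (x \<otimes> z)"
    and bracket_smult_right: "\<lbrakk>x \<in> carrier L; y \<in> carrier L\<rbrakk> \<Longrightarrow>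
          x \<otimes> (c \<odot>\<^bsub>L\<^esub> y) = c \<odot>\<^bsub>L\<^esub> (x \<otimes> y)"
    and bracket_self: "x \<in> carrier L \<Longrightarrow> x \<otimes> x = \<zero>"
    and jacobi: "\<lbrakk>x \<in> carrier L; y \<in> carrier L; z \<in> carrier L\<rbrakk> \<Longrightarrow>
          (x \<otimes> (y \<otimes> z)) \<oplus> (y \<otimes> (z \<otimes> x)) \<oplus> (z \<otimes> (x \<otimes> y)) = \<zero>"

locale lie_module = L: lie_algebra L + V: vectorspace "class_ring :: complex ring" V
  for L :: "(complex, 'g) module" (structure) and V :: "(complex, 'v) module" (structure) +
  fixes act :: "'g \<Rightarrow> 'v \<Rightarrow> 'v"
  assumes act_closed: "\<lbrakk>x \<in> carrier L; v \<in> carrier V\<rbrakk> \<Longrightarrow> act x v \<in> carrier V"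
    and act_add_left: "\<lbrakk>x \<in> carrier L; y \<in> carrier L; v \<in> carrier V\<rbrakk> \<Longrightarrow>
          act (x \<oplus>\<^bsub>L\<^esub> y) v = act x v \<oplus>\<^bsub>V\<^esub> act y v"
    and act_smult_left: "\<lbrakk>x \<in> carrier L; v \<in> carrier V\<rbrakk> \<Longrightarrow>
          act (c \<odot>\<^bsub>L\<^esub> x) v = c \<odot>\<^bsub>V\<^esub> act x v"
    and act_add_right: "\<lbrakk>x \<in> carrier L; v \<in> carrier V; w \<in> carrier V\<rbrakk> \<Longrightarrow>
          act x (v \<oplus>\<^bsub>V\<^esub> w) = act x v \<oplus>\<^bsub>V\<^esub> act x w"
    and act_smult_right: "\<lbrakk>x \<in> carrier L; v \<in> carrier V\<rbrakk> \<Longrightarrow>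
          act x (c \<odot>\<^bsub>V\<^esub> v) = c \<odot>\<^bsub>V\<^esub> act x v"
    and act_bracket: "\<lbrakk>x \<in> carrier L; y \<in> carrier L; v \<in> carrier V\<rbrakk> \<Longrightarrow>
          act (x \<otimes>\<^bsub>L\<^esub> y) v = act x (act y v) \<ominus>\<^bsub>V\<^esub> act y (act x v)"

definition lie_submodule ::
  "(complex, 'g) module \<Rightarrow> (complex, 'v) module \<Rightarrow> ('g \<Rightarrow> 'v \<Rightarrow> 'v) \<Rightarrow> 'v set \<Rightarrow> bool" where
  "lie_submodule L V act W \<longleftrightarrow>
     submodule class_ring W V \<and> (\<forall>x\<in>carrier L. \<forall>w\<in>W. act x w \<in> W)"

definition simple_lie_module ::
  "(complex, 'g) module \<Rightarrow> (complex, 'v) module \<Rightarrow> ('g \<Rightarrow> 'v \<Rightarrow> 'v) \<Rightarrow> bool" where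
  "simple_lie_module L V act \<longleftrightarrow>
     lie_module L V act \<and> carrier V \<noteq> {\<zero>\<^bsub>V\<^esub>} \<and>
     (\<forall>W. lie_submodule L V act W \<longrightarrow> W = {\<zero>\<^bsub>V\<^esub>} \<or> W = carrier V)"

definition trivial_lie_module ::
  "(complex, 'g) module \<Rightarrow> (complex, 'v) module \<Rightarrow> ('g \<Rightarrow> 'v \<Rightarrow> 'v) \<Rightarrow> bool" where
  "trivial_lie_module L V act \<longleftrightarrow>
     (\<forall>x\<in>carrier L. \<forall>v\<in>carrier V. act x v = \<zero>\<^bsub>V\<^esub>)"

definition lie_module_iso ::
  "(complex, 'g) module \<Rightarrow> (complex, 'v) module \<Rightarrow> ('g \<Rightarrow> 'v \<Rightarrow> 'v) \<Rightarrow>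
   (complex, 'w) module \<Rightarrow> ('g \<Rightarrow> 'w \<Rightarrow> 'w) \<Rightarrow> bool" where
  "lie_module_iso L V act W act' \<longleftrightarrow>
     lie_module L V act \<and> lie_module L W act' \<and>
     (\<exists>f. linear_map class_ring V W f \<and> bij_betw f (carrier V) (carrier W) \<and>
          (\<forall>x\<in>carrier L. \<forall>v\<in>carrier V. f (act x v) = act' x (f v)))"


section \<open>The universal enveloping algebra\<close>

text \<open>Concatenation makes the lists over \<open>S\<close> the free monoid on \<open>S\<close>, so that
  \<^typ>\<open>'a list \<Rightarrow>\<^sub>0 complex\<close> is the free associative unital algebra over \<open>\<complex>\<close>.\<close>

instantiation list :: (type) monoid_add
begin
definition zero_list :: "'a list" where "zero_list = []"
definition plus_list :: "'a list \<Rightarrow> 'a list \<Rightarrow> 'a list" where "plus_list = (@)"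
instance by standard (simp_all add: zero_list_def plus_list_def)
end

definition free_algebra :: "'a set \<Rightarrow> ('a list \<Rightarrow>\<^sub>0 complex) ring" where
  "free_algebra S =
     \<lparr>carrier = {p. Poly_Mapping.keys p \<subseteq> lists S}, mult = (*), one = 1, ring.zero = 0, add = (+)\<rparr>"

definition free_gen :: "'a \<Rightarrow> 'a list \<Rightarrow>\<^sub>0 complex" where
  "free_gen x = Poly_Mapping.single [x] 1"

definition free_const :: "complex \<Rightarrow> 'a list \<Rightarrow>\<^sub>0 complex" where
  "free_const c = Poly_Mapping.single [] c"

text \<open>The first two families of relations cut the free algebra on the set \<open>carrier L\<close> down to the
  tensor algebra of the vector space \<open>L\<close>, the third is \<open>xy - yx = [x, y]\<close>.\<close>

definition env_rels :: "(complex, 'g) module \<Rightarrow> ('g list \<Rightarrow>\<^sub>0 complex) set" where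
  "env_rels L =
     {free_gen (x \<oplus>\<^bsub>L\<^esub> y) - free_gen x - free_gen y | x y. x \<in> carrier L \<and> y \<in> carrier L} \<union>
     {free_gen (c \<odot>\<^bsub>L\<^esub> x) - free_const c * free_gen x | c x. x \<in> carrier L} \<union>
     {free_gen x * free_gen y - free_gen y * free_gen x - free_gen (x \<otimes>\<^bsub>L\<^esub> y) | x y.
        x \<in> carrier L \<and> y \<in> carrier L}"

definition env_ideal :: "(complex, 'g) module \<Rightarrow> ('g list \<Rightarrow>\<^sub>0 complex) set" where
  "env_ideal L = Idl\<^bsub>free_algebra (carrier L)\<^esub> (env_rels L)"

definition env_alg :: "(complex, 'g) module \<Rightarrow> ('g list \<Rightarrow>\<^sub>0 complex) set ring" where
  "env_alg L = free_algebra (carrier L) Quot env_ideal L"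

definition env_class :: "(complex, 'g) module \<Rightarrow> ('g list \<Rightarrow>\<^sub>0 complex) \<Rightarrow> ('g list \<Rightarrow>\<^sub>0 complex) set" where
  "env_class L p = env_ideal L +>\<^bsub>free_algebra (carrier L)\<^esub> p"

text \<open>Maps out of a quotient are defined by applying \<^const>\<open>the_elem\<close> to the set of values on all
  representatives, which is a singleton in every use below.

  For a subalgebra \<open>H\<close> of \<open>L\<close>, \<open>env_incl L\<close> is the homomorphism \<open>U(H) \<rightarrow> U(L)\<close> that
  extends the inclusion.\<close>

definition env_incl ::
  "(complex, 'g) module \<Rightarrow> ('g list \<Rightarrow>\<^sub>0 complex) set \<Rightarrow> ('g list \<Rightarrow>\<^sub>0 complex) set" where
  "env_incl L X = the_elem (env_class L ` X)"

definition free_act ::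
  "(complex, 'v) module \<Rightarrow> ('g \<Rightarrow> 'v \<Rightarrow> 'v) \<Rightarrow> ('g list \<Rightarrow>\<^sub>0 complex) \<Rightarrow> 'v \<Rightarrow> 'v" where
  "free_act V act p v =
     (\<Oplus>\<^bsub>V\<^esub>w\<in>Poly_Mapping.keys p. Poly_Mapping.lookup p w \<odot>\<^bsub>V\<^esub> foldr act w v)"

definition env_act ::
  "(complex, 'v) module \<Rightarrow> ('g \<Rightarrow> 'v \<Rightarrow> 'v) \<Rightarrow> ('g list \<Rightarrow>\<^sub>0 complex) set \<Rightarrow> 'v \<Rightarrow> 'v" where
  "env_act V act X v = the_elem ((\<lambda>p. free_act V act p v) ` X)"


section \<open>Induced modules\<close>

text \<open>The balanced tensor product \<open>M \<otimes>\<^sub>R N\<close> over a ring \<open>R\<close>, not necessarily commutative, of a right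
  module \<open>M\<close> with action \<open>ra\<close> and a left module \<open>N\<close> with action \<open>la\<close>.  It is a multiplicatively
  written abelian group.\<close>

definition tensor_rels ::
  "('r, 'x) ring_scheme \<Rightarrow> ('m, 'y) ring_scheme \<Rightarrow> ('m \<Rightarrow> 'r \<Rightarrow> 'm) \<Rightarrow>
   ('n, 'z) ring_scheme \<Rightarrow> ('r \<Rightarrow> 'n \<Rightarrow> 'n) \<Rightarrow> ('m \<times> 'n \<Rightarrow>\<^sub>0 int) set" where
  "tensor_rels R M ra N la =
     {frag_of (m \<oplus>\<^bsub>M\<^esub> m', n) - frag_of (m, n) - frag_of (m', n) | m m' n.
        m \<in> carrier M \<and> m' \<in> carrier M \<and> n \<in> carrier N} \<union>
     {frag_of (m, n \<oplus>\<^bsub>N\<^esub> n') - frag_of (m, n) - frag_of (m, n') | m n n'.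
        m \<in> carrier M \<and> n \<in> carrier N \<and> n' \<in> carrier N} \<union>
     {frag_of (ra m r, n) - frag_of (m, la r n) | m r n.
        m \<in> carrier M \<and> r \<in> carrier R \<and> n \<in> carrier N}"

definition tensor_kernel ::
  "('r, 'x) ring_scheme \<Rightarrow> ('m, 'y) ring_scheme \<Rightarrow> ('m \<Rightarrow> 'r \<Rightarrow> 'm) \<Rightarrow>
   ('n, 'z) ring_scheme \<Rightarrow> ('r \<Rightarrow> 'n \<Rightarrow> 'n) \<Rightarrow> ('m \<times> 'n \<Rightarrow>\<^sub>0 int) set" where
  "tensor_kernel R M ra N la =
     generate (free_Abelian_group (carrier M \<times> carrier N)) (tensor_rels R M ra N la)"

definition tensor_product ::
  "('r, 'x) ring_scheme \<Rightarrow> ('m, 'y) ring_scheme \<Rightarrow> ('m \<Rightarrow> 'r \<Rightarrow> 'm) \<Rightarrow>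
   ('n, 'z) ring_scheme \<Rightarrow> ('r \<Rightarrow> 'n \<Rightarrow> 'n) \<Rightarrow> ('m \<times> 'n \<Rightarrow>\<^sub>0 int) set monoid" where
  "tensor_product R M ra N la =
     free_Abelian_group (carrier M \<times> carrier N) Mod tensor_kernel R M ra N la"

type_synonym ('g, 'v) ind = "(('g list \<Rightarrow>\<^sub>0 complex) set \<times> 'v \<Rightarrow>\<^sub>0 int) set"

text \<open>For a subalgebra \<open>H\<close> of \<open>L\<close> and an \<open>H\<close>-module \<open>E\<close>: the group \<open>U(L) \<otimes>\<^bsub>U(H)\<^esub> E\<close>, its left
  multiplication \<open>a \<cdot> (u \<otimes> e) = au \<otimes> e\<close> by elements \<open>a\<close> of \<open>U(L)\<close>, and the resulting \<open>L\<close>-module.\<close>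

definition ind_kernel ::
  "(complex, 'g) module \<Rightarrow> (complex, 'g) module \<Rightarrow> (complex, 'v) module \<Rightarrow> ('g \<Rightarrow> 'v \<Rightarrow> 'v) \<Rightarrow>
   ('g, 'v) ind" where
  "ind_kernel L H E act =
     tensor_kernel (env_alg H) (env_alg L) (\<lambda>u h. u \<otimes>\<^bsub>env_alg L\<^esub> env_incl L h) E (env_act E act)"

definition ind_group ::
  "(complex, 'g) module \<Rightarrow> (complex, 'g) module \<Rightarrow> (complex, 'v) module \<Rightarrow> ('g \<Rightarrow> 'v \<Rightarrow> 'v) \<Rightarrow>
   ('g, 'v) ind monoid" where
  "ind_group L H E act =
     tensor_product (env_alg H) (env_alg L) (\<lambda>u h. u \<otimes>\<^bsub>env_alg L\<^esub> env_incl L h) E (env_act E act)"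

definition ind_lmult ::
  "(complex, 'g) module \<Rightarrow> (complex, 'g) module \<Rightarrow> (complex, 'v) module \<Rightarrow> ('g \<Rightarrow> 'v \<Rightarrow> 'v) \<Rightarrow>
   ('g list \<Rightarrow>\<^sub>0 complex) set \<Rightarrow> ('g, 'v) ind \<Rightarrow> ('g, 'v) ind" where
  "ind_lmult L H E act a T =
     the_elem ((\<lambda>z. ind_kernel L H E act #>\<^bsub>free_Abelian_group (carrier (env_alg L) \<times> carrier E)\<^esub>
                  frag_extend (\<lambda>(u, e). frag_of (a \<otimes>\<^bsub>env_alg L\<^esub> u, e)) z) ` T)"

definition induced_module ::
  "(complex, 'g) module \<Rightarrow> (complex, 'g) module \<Rightarrow> (complex, 'v) module \<Rightarrow> ('g \<Rightarrow> 'v \<Rightarrow> 'v) \<Rightarrow>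
   (complex, ('g, 'v) ind) module" where
  "induced_module L H E act =
     \<lparr>carrier = carrier (ind_group L H E act), mult = undefined, one = undefined,
      ring.zero = \<one>\<^bsub>ind_group L H E act\<^esub>, add = (\<otimes>\<^bsub>ind_group L H E act\<^esub>),
      smult = (\<lambda>c. ind_lmult L H E act (env_class L (free_const c)))\<rparr>"

definition induced_act ::
  "(complex, 'g) module \<Rightarrow> (complex, 'g) module \<Rightarrow> (complex, 'v) module \<Rightarrow> ('g \<Rightarrow> 'v \<Rightarrow> 'v) \<Rightarrow>
   'g \<Rightarrow> ('g, 'v) ind \<Rightarrow> ('g, 'v) ind" where
  "induced_act L H E act x = ind_lmult L H E act (env_class L (free_gen x))"


section \<open>Derivations of the polynomial ring in one variable\<close>

type_synonym der = "complex poly \<Rightarrow> complex poly"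

definition derivations :: "der set" where
  "derivations = {D. (\<forall>p q. D (p + q) = D p + D q) \<and>
                     (\<forall>c p. D (Polynomial.smult c p) = Polynomial.smult c (D p)) \<and>
                     (\<forall>p q. D (p * q) = D p * q + p * D q)}"

definition W1 :: "(complex, der) module" where
  "W1 = \<lparr>carrier = derivations, mult = (\<lambda>D D' p. D (D' p) - D' (D p)), one = undefined,
         ring.zero = (\<lambda>p. 0), add = (\<lambda>D D' p. D p + D' p), smult = (\<lambda>c D p. Polynomial.smult c (D p))\<rparr>"

text \<open>\<open>\<g>\<^sub>k = \<complex> t\<^sup>k\<^sup>+\<^sup>1 \<partial>\<close>, for \<open>k \<ge> -1\<close> only.\<close>

definition W1_comp :: "int \<Rightarrow> der set" where
  "W1_comp k = {\<lambda>p. Polynomial.smult c (monom 1 (nat (k + 1)) * pderiv p) | c. True}"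

definition W1_ge :: "int \<Rightarrow> (complex, der) module" where
  "W1_ge r = W1\<lparr>carrier :=
     LinearCombinations.module.span class_ring W1 (\<Union>k\<in>{k. k \<ge> -1 \<and> k \<ge> r}. W1_comp k)\<rparr>"

definition smooth_module :: "(complex, 'v) module \<Rightarrow> (der \<Rightarrow> 'v \<Rightarrow> 'v) \<Rightarrow> bool" where
  "smooth_module V act \<longleftrightarrow>
     (\<forall>v\<in>carrier V. \<exists>m::nat. \<forall>i\<ge>int m. \<forall>x\<in>W1_comp i. act x v = \<zero>\<^bsub>V\<^esub>)"

definition inv_space :: "(complex, 'v) module \<Rightarrow> (der \<Rightarrow> 'v \<Rightarrow> 'v) \<Rightarrow> nat \<Rightarrow> 'v set" where
  "inv_space V act r = {v \<in> carrier V. \<forall>x\<in>carrier (W1_ge (int r)). act x v = \<zero>\<^bsub>V\<^esub>}"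

definition inv_module ::
  "(complex, 'v) module \<Rightarrow> (der \<Rightarrow> 'v \<Rightarrow> 'v) \<Rightarrow> nat \<Rightarrow> (complex, 'v) module" where
  "inv_module V act r = V\<lparr>carrier := inv_space V act r\<rparr>"

definition height :: "(complex, 'v) module \<Rightarrow> (der \<Rightarrow> 'v \<Rightarrow> 'v) \<Rightarrow> nat" where
  "height V act = (LEAST r. inv_space V act r \<noteq> {\<zero>\<^bsub>V\<^esub>})"

end

theory Submission
  imports Defs "HOL-Computational_Algebra.Fundamental_Theorem_Algebra"
begin

text \<open>Write \<open>d\<^sub>k\<close> for \<open>t\<^sup>k\<^sup>+\<^sup>1 \<partial>\<close>, let \<open>E = V\<^sup>(\<^sup>1\<^sup>)\<close> and \<open>H\<close> be the subalgebra spanned by the \<open>d\<^sub>k\<close> with \<open>k \<ge> 0\<close>.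
On \<open>E\<close> only the Euler field \<open>d\<^sub>0\<close> acts, and it acts injectively, because a vector of \<open>E\<close> that \<open>d\<^sub>0\<close> kills
lies in \<open>V\<^sup>(\<^sup>0\<^sup>)\<close>, which is zero.

The decisive computation is \<open>d\<^sub>k \<partial>\<^sup>i w = 0\<close> for \<open>i < k\<close> and \<open>d\<^sub>k \<partial>\<^sup>k w = c d\<^sub>0 w\<close> with
\<open>c \<noteq> 0\<close>, for \<open>w\<close> in \<open>E\<close>. Applying \<open>d\<^sub>N\<close> to an element \<open>\<Sum>\<^sub>i\<^sub>\<le>\<^sub>N \<partial>\<^sup>i w\<^sub>i\<close> therefore isolates its top
coefficient, and injectivity of \<open>d\<^sub>0\<close> turns this into \<open>power_sum_in_E\<close>: if the sum lies in \<open>E\<close>, then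
\<open>w\<^sub>i = 0\<close> for all \<open>i > 0\<close>. In other words the powers of \<open>\<partial>\<close> are independent over \<open>E\<close>.

On the other hand \<open>U(W\<^sub>1) = \<Sum>\<^sub>i \<partial>\<^sup>i U(H)\<close> (\<open>pbw_spanned_all\<close>), and by simplicity every nonzero vector
generates \<open>V\<close>. If \<open>v\<close> is a nonzero vector of \<open>E\<close>, each \<open>e\<close> in \<open>E\<close> is thus of the form
\<open>\<Sum>\<^sub>i \<partial>\<^sup>i q\<^sub>i v\<close> with \<open>q\<^sub>i\<close> in \<open>U(H)\<close>, and independence leaves \<open>e = q\<^sub>0 v\<close>. So \<open>E\<close> is a simple
\<open>H\<close>-module (\<open>E_cyclic\<close>). In particular \<open>v = q d\<^sub>0 v\<close> for some \<open>q\<close>, which acts on \<open>E\<close> as a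
polynomial in \<open>d\<^sub>0\<close>. Hence a nonzero polynomial in \<open>d\<^sub>0\<close> kills \<open>v\<close>, there is an eigenvector of \<open>d\<^sub>0\<close> in
\<open>E\<close>, and \<open>E\<close>, being generated by it, is a line.

For the isomorphism, the group \<open>U(W\<^sub>1) \<otimes>\<^bsub>U(H)\<^esub> E\<close> is a quotient of the free abelian group on pairs
\<open>(u, e)\<close>, and \<open>(u, e) \<mapsto> u e\<close> defines a homomorphism from the latter to \<open>V\<close>. Once its kernel is shown to be
exactly the subgroup of tensor relations, the elements of the induced module are the fibres of this
homomorphism, and the module structure of the induced module, including its axioms and the independence of
representatives, is carried over from \<open>V\<close> (\<open>induced_module_iso\<close>). Modulo the relations every element is of
the form \<open>p \<otimes> v\<close>. If \<open>p v = 0\<close> with \<open>p = \<Sum>\<^sub>i \<partial>\<^sup>i q\<^sub>i\<close>, independence gives \<open>q\<^sub>i v = 0\<close> for all \<open>i\<close>, so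
\<open>p \<otimes> v = \<Sum>\<^sub>i \<partial>\<^sup>i \<otimes> q\<^sub>i v = 0\<close>.\<close>


section \<open>The free algebra\<close>

lemma free_algebra_iff: "p \<in> carrier (free_algebra S) \<longleftrightarrow> Poly_Mapping.keys p \<subseteq> lists S"
  by (simp add: free_algebra_def)

lemma free_algebra_simps [simp]:
  "x \<otimes>\<^bsub>free_algebra S\<^esub> y = x * y" "x \<oplus>\<^bsub>free_algebra S\<^esub> y = x + y"
  "\<zero>\<^bsub>free_algebra S\<^esub> = 0" "\<one>\<^bsub>free_algebra S\<^esub> = 1"
  by (simp_all add: free_algebra_def)

lemma free_algebra_add: "\<lbrakk>p \<in> carrier (free_algebra S); q \<in> carrier (free_algebra S)\<rbrakk> \<Longrightarrow>
    p + q \<in> carrier (free_algebra S)"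
  using keys_add[of p q] by (auto simp: free_algebra_iff)

lemma free_algebra_uminus: "p \<in> carrier (free_algebra S) \<Longrightarrow> - p \<in> carrier (free_algebra S)"
  by (simp add: free_algebra_iff)

lemma free_algebra_mult: "\<lbrakk>p \<in> carrier (free_algebra S); q \<in> carrier (free_algebra S)\<rbrakk> \<Longrightarrow>
    p * q \<in> carrier (free_algebra S)"
  unfolding free_algebra_iff
  using keys_mult[of p q] by (fastforce simp: plus_list_def)

lemma free_algebra_single: "w \<in> lists S \<Longrightarrow> Poly_Mapping.single w c \<in> carrier (free_algebra S)"
  by (simp add: free_algebra_iff)

lemma free_algebra_const: "free_const c \<in> carrier (free_algebra S)"
  by (simp add: free_const_def free_algebra_single)

lemma free_algebra_gen: "x \<in> S \<Longrightarrow> free_gen x \<in> carrier (free_algebra S)"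
  by (simp add: free_gen_def free_algebra_single)

lemma free_const_0: "free_const 0 = 0"
  by (simp add: free_const_def)

lemma free_const_1: "free_const 1 = 1"
  by (metis free_const_def single_one zero_list_def)

lemma free_algebra_0: "0 \<in> carrier (free_algebra S)"
  and free_algebra_1: "1 \<in> carrier (free_algebra S)"
  using free_algebra_const[of 0 S] free_algebra_const[of 1 S]
  by (simp_all add: free_const_0 free_const_1)

lemma free_algebra_diff: "\<lbrakk>p \<in> carrier (free_algebra S); q \<in> carrier (free_algebra S)\<rbrakk> \<Longrightarrow>
    p - q \<in> carrier (free_algebra S)"
  using free_algebra_add[of p S "- q"] free_algebra_uminus[of q S] by simp

lemma free_algebra_power: "p \<in> carrier (free_algebra S) \<Longrightarrow> p ^ n \<in> carrier (free_algebra S)"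
  by (induction n) (auto intro: free_algebra_1 free_algebra_mult)

lemma free_algebra_sum: "(\<And>i. i \<in> A \<Longrightarrow> f i \<in> carrier (free_algebra S)) \<Longrightarrow>
    sum f A \<in> carrier (free_algebra S)"
  by (induction A rule: infinite_finite_induct) (auto intro: free_algebra_0 free_algebra_add)

lemmas free_algebra_closed = free_algebra_0 free_algebra_1 free_algebra_add free_algebra_uminus
  free_algebra_diff free_algebra_mult free_algebra_power free_algebra_sum free_algebra_const
  free_algebra_gen

lemma free_algebra_mono: "S \<subseteq> T \<Longrightarrow> carrier (free_algebra S) \<subseteq> carrier (free_algebra T)"
  using lists_mono[of S T] by (auto simp: free_algebra_iff)

lemma free_const_add: "free_const (a + b) = free_const a + free_const b"
  by (simp add: free_const_def single_add)

lemma free_const_uminus: "free_const (- a) = - free_const a"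
  by (simp add: free_const_def single_uminus)

lemma free_const_mult: "free_const (a * b) = free_const a * free_const b"
  by (simp add: free_const_def mult_single plus_list_def)

lemma free_gen_mult_single: "free_gen x * Poly_Mapping.single w c = Poly_Mapping.single (x # w) c"
  by (simp add: free_gen_def mult_single plus_list_def)

lemma free_const_mult_single:
  "free_const a * Poly_Mapping.single w c = Poly_Mapping.single w (a * c)"
  "Poly_Mapping.single w c * free_const a = Poly_Mapping.single w (c * a)"
  by (simp_all add: free_const_def mult_single plus_list_def)

lemma poly_mapping_sum_single:
  "p = (\<Sum>k\<in>Poly_Mapping.keys p. Poly_Mapping.single k (Poly_Mapping.lookup p k))"
  by (rule poly_mapping_eqI)
    (auto simp: lookup_sum lookup_single when_def in_keys_iff sum.delta' cong: if_cong)

lemma free_algebra_single_induct [consumes 1, case_names single add]: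
  assumes p: "p \<in> carrier (free_algebra S)"
    and single: "\<And>w c. w \<in> lists S \<Longrightarrow> P (Poly_Mapping.single w c)"
    and add: "\<And>p q. \<lbrakk>p \<in> carrier (free_algebra S); q \<in> carrier (free_algebra S); P p; P q\<rbrakk> \<Longrightarrow>
      P (p + q)"
  shows "P p"
proof -
  have zero: "P 0"
    using single[of "[]" 0] by simp
  have "P (\<Sum>k\<in>A. Poly_Mapping.single k (f k))" if "finite A" "A \<subseteq> lists S" for A f
    using that
  proof (induction A rule: finite_induct)
    case (insert k A)
    then show ?case
      by (auto intro!: add single free_algebra_sum free_algebra_single)
  qed (simp add: zero)
  then show ?thesis
    using p by (subst poly_mapping_sum_single[of p]) (simp add: free_algebra_iff)
qed

text \<open>The free algebra is the smallest subspace that contains the constants and is stable under left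
multiplication by the generators. Statements about \<open>p v\<close> for a module element \<open>v\<close> follow this pattern,
since the leftmost letter of a word acts last.\<close>
lemma free_algebra_induct [consumes 1, case_names const gen add]:
  assumes p: "p \<in> carrier (free_algebra S)"
    and const: "\<And>c. P (free_const c)"
    and gen: "\<And>x p. \<lbrakk>x \<in> S; p \<in> carrier (free_algebra S); P p\<rbrakk> \<Longrightarrow> P (free_gen x * p)"
    and add: "\<And>p q. \<lbrakk>p \<in> carrier (free_algebra S); q \<in> carrier (free_algebra S); P p; P q\<rbrakk> \<Longrightarrow>
      P (p + q)"
  shows "P p"
  using p
proof (induction rule: free_algebra_single_induct)
  case (single w c)
  then show ?case
  proof (induction w)
    case Nil
    then show ?case using const[of c] by (simp add: free_const_def)
  next
    case (Cons x w)
    then show ?case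
      using gen[of x "Poly_Mapping.single w c"]
      by (simp add: free_gen_mult_single free_algebra_single)
  qed
qed (rule add)

lemma free_const_commute: "free_const c * p = p * free_const c"
proof -
  have "p \<in> carrier (free_algebra UNIV)"
    by (simp add: free_algebra_iff)
  then show ?thesis
    by (induction rule: free_algebra_single_induct)
      (simp_all add: free_const_mult_single algebra_simps)
qed

lemma ring_free_algebra: "ring (free_algebra S)"
proof (rule ringI)
  show "abelian_group (free_algebra S)"
    by (rule abelian_groupI)
      (auto intro: free_algebra_closed simp: algebra_simps
        intro!: bexI[of _ "- x" for x])
  show "Group.monoid (free_algebra S)"
    by (rule Group.monoidI) (auto intro: free_algebra_closed simp: algebra_simps)
qed (auto simp: algebra_simps)


section \<open>The enveloping algebra\<close>

context lie_algebra
begin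

lemma env_rels_closed: "env_rels L \<subseteq> carrier (free_algebra (carrier L))"
  by (auto simp: env_rels_def intro!: free_algebra_closed bracket_closed)

lemma ideal_env_ideal: "ideal (env_ideal L) (free_algebra (carrier L))"
  unfolding env_ideal_def by (rule ring.genideal_ideal[OF ring_free_algebra env_rels_closed])

lemma env_rels_in_ideal: "env_rels L \<subseteq> env_ideal L"
  unfolding env_ideal_def by (rule ring.genideal_self[OF ring_free_algebra env_rels_closed])

lemma env_ideal_minimal:
  "\<lbrakk>ideal I (free_algebra (carrier L)); env_rels L \<subseteq> I\<rbrakk> \<Longrightarrow> env_ideal L \<subseteq> I"
  unfolding env_ideal_def by (rule ring.genideal_minimal[OF ring_free_algebra])

lemma env_ideal_carrier: "p \<in> env_ideal L \<Longrightarrow> p \<in> carrier (free_algebra (carrier L))"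
  using ideal.Icarr[OF ideal_env_ideal] .

lemma env_ideal_0: "0 \<in> env_ideal L"
  using additive_subgroup.zero_closed[OF ideal.axioms(1)[OF ideal_env_ideal]] by simp

lemma env_ideal_add: "\<lbrakk>p \<in> env_ideal L; q \<in> env_ideal L\<rbrakk> \<Longrightarrow> p + q \<in> env_ideal L"
  using additive_subgroup.a_closed[OF ideal.axioms(1)[OF ideal_env_ideal]] by simp

lemma env_ideal_lmult:
  "\<lbrakk>p \<in> carrier (free_algebra (carrier L)); q \<in> env_ideal L\<rbrakk> \<Longrightarrow> p * q \<in> env_ideal L"
  using ideal.I_l_closed[OF ideal_env_ideal] by simp

lemma env_ideal_rmult:
  "\<lbrakk>p \<in> carrier (free_algebra (carrier L)); q \<in> env_ideal L\<rbrakk> \<Longrightarrow> q * p \<in> env_ideal L"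
  using ideal.I_r_closed[OF ideal_env_ideal] by simp

lemma env_ideal_uminus: "q \<in> env_ideal L \<Longrightarrow> - q \<in> env_ideal L"
  using env_ideal_lmult[OF free_algebra_const[of "-1"]] by (simp add: free_const_uminus free_const_1)

lemma env_class_alt: "env_class L p = {q + p | q. q \<in> env_ideal L}"
  by (auto simp: env_class_def a_r_coset_def' free_algebra_def)

lemma env_class_eq_iff: "env_class L p = env_class L q \<longleftrightarrow> p - q \<in> env_ideal L"
proof
  assume "env_class L p = env_class L q"
  moreover have "p \<in> env_class L p"
    using env_ideal_0 by (auto simp: env_class_alt)
  ultimately show "p - q \<in> env_ideal L"
    by (auto simp: env_class_alt)
next
  have *: "env_class L p \<subseteq> env_class L q" if pq: "p - q \<in> env_ideal L" for p q
  proof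
    fix r assume "r \<in> env_class L p"
    then obtain s where s: "s \<in> env_ideal L" "r = s + p" by (auto simp: env_class_alt)
    moreover have "s + p = (s + (p - q)) + q" by simp
    ultimately show "r \<in> env_class L q"
      using pq env_ideal_add unfolding env_class_alt by blast
  qed
  assume "p - q \<in> env_ideal L"
  with *[of p q] *[of q p] env_ideal_uminus[of "p - q"] show "env_class L p = env_class L q" by simp
qed

lemma carrier_env_alg: "carrier (env_alg L) = env_class L ` carrier (free_algebra (carrier L))"
  by (auto simp: env_alg_def FactRing_def env_class_def A_RCOSETS_def')

lemma env_alg_mult:
  "\<lbrakk>p \<in> carrier (free_algebra (carrier L)); q \<in> carrier (free_algebra (carrier L))\<rbrakk> \<Longrightarrow>
    env_class L p \<otimes>\<^bsub>env_alg L\<^esub> env_class L q = env_class L (p * q)"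
  using ideal.rcoset_mult_add[OF ideal_env_ideal, of p q]
  by (simp add: env_alg_def FactRing_def env_class_def)

lemma env_alg_add:
  "\<lbrakk>p \<in> carrier (free_algebra (carrier L)); q \<in> carrier (free_algebra (carrier L))\<rbrakk> \<Longrightarrow>
    env_class L p \<oplus>\<^bsub>env_alg L\<^esub> env_class L q = env_class L (p + q)"
  using ideal.a_rcos_sum[OF ideal_env_ideal, of p q]
  by (simp add: env_alg_def FactRing_def env_class_def)

lemma env_ideal_gen_add:
  "\<lbrakk>x \<in> carrier L; y \<in> carrier L\<rbrakk> \<Longrightarrow> free_gen (x \<oplus> y) - free_gen x - free_gen y \<in> env_ideal L"
  by (rule subsetD[OF env_rels_in_ideal]) (unfold env_rels_def, blast)

lemma env_ideal_gen_smult: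
  "x \<in> carrier L \<Longrightarrow> free_gen (c \<odot>\<^bsub>L\<^esub> x) - free_const c * free_gen x \<in> env_ideal L"
  by (rule subsetD[OF env_rels_in_ideal]) (unfold env_rels_def, blast)

lemma env_ideal_gen_bracket:
  "\<lbrakk>x \<in> carrier L; y \<in> carrier L\<rbrakk> \<Longrightarrow>
    free_gen x * free_gen y - free_gen y * free_gen x - free_gen (x \<otimes> y) \<in> env_ideal L"
  by (rule subsetD[OF env_rels_in_ideal]) (unfold env_rels_def, blast)

end


section \<open>Modules over the enveloping algebra\<close>

lemma (in Module.module) finsum_submodule:
  assumes N: "submodule R N M" and f: "f \<in> A \<rightarrow> N"
  shows "finsum (M\<lparr>carrier := N\<rparr>) f A = finsum M f A"
proof -
  interpret N: Module.module R "M\<lparr>carrier := N\<rparr>"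
    by (rule submodule_is_module[OF N])
  have NM: "N \<subseteq> carrier M"
    using submodule.subset[OF N] .
  show ?thesis
    using f
  proof (induction A rule: infinite_finite_induct)
    case (insert x A)
    then have "f \<in> A \<rightarrow> carrier M" "f x \<in> carrier M" "f \<in> A \<rightarrow> N" "f x \<in> N"
      using NM by auto
    with insert show ?case by simp
  qed (simp_all add: finsum_infinite N.finsum_infinite)
qed

context lie_module
begin

lemma foldr_act_closed:
  "\<lbrakk>w \<in> lists (carrier L); v \<in> carrier V\<rbrakk> \<Longrightarrow> foldr act w v \<in> carrier V"
  by (induction w) (auto intro: act_closed)

text \<open>Two elements of the free algebra have different supports; summing over a common finite superset makes the
action visibly additive.\<close>
lemma free_act_superset:
  assumes "finite A" "Poly_Mapping.keys p \<subseteq> A" "A \<subseteq> lists (carrier L)" "v \<in> carrier V"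
  shows "free_act V act p v =
    (\<Oplus>\<^bsub>V\<^esub>w\<in>A. Poly_Mapping.lookup p w \<odot>\<^bsub>V\<^esub> foldr act w v)"
  unfolding free_act_def
proof (rule V.add.finprod_mono_neutral_cong_left[OF assms(1,2)])
  have closed: "foldr act w v \<in> carrier V" if "w \<in> A" for w
    using assms that foldr_act_closed by blast
  show "Poly_Mapping.lookup p w \<odot>\<^bsub>V\<^esub> foldr act w v = \<zero>\<^bsub>V\<^esub>" if "w \<in> A - Poly_Mapping.keys p" for w
    using that closed[of w] V.lmult_0 by (auto simp: in_keys_iff)
  show "(\<lambda>w. Poly_Mapping.lookup p w \<odot>\<^bsub>V\<^esub> foldr act w v) \<in> A \<rightarrow> carrier V"
    using closed by auto
qed simp

lemma free_act_single:
  assumes "w \<in> lists (carrier L)" "v \<in> carrier V"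
  shows "free_act V act (Poly_Mapping.single w c) v = c \<odot>\<^bsub>V\<^esub> foldr act w v"
  using assms foldr_act_closed[OF assms] by (subst free_act_superset[of "{w}"]) auto

lemma free_act_add_left:
  assumes p: "p \<in> carrier (free_algebra (carrier L))" and q: "q \<in> carrier (free_algebra (carrier L))"
    and v: "v \<in> carrier V"
  shows "free_act V act (p + q) v = free_act V act p v \<oplus>\<^bsub>V\<^esub> free_act V act q v"
proof -
  let ?A = "Poly_Mapping.keys p \<union> Poly_Mapping.keys q"
  have A: "finite ?A" "?A \<subseteq> lists (carrier L)"
    using p q by (auto simp: free_algebra_iff)
  have closed: "foldr act w v \<in> carrier V" if "w \<in> ?A" for w
    using A that v foldr_act_closed by blast
  have sub: "Poly_Mapping.keys (p + q) \<subseteq> ?A" "Poly_Mapping.keys p \<subseteq> ?A" "Poly_Mapping.keys q \<subseteq> ?A"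
    using keys_add[of p q] by auto
  let ?t = "\<lambda>p w. Poly_Mapping.lookup p w \<odot>\<^bsub>V\<^esub> foldr act w v"
  have "(\<Oplus>\<^bsub>V\<^esub>w\<in>?A. ?t (p + q) w) = (\<Oplus>\<^bsub>V\<^esub>w\<in>?A. ?t p w \<oplus>\<^bsub>V\<^esub> ?t q w)"
    using closed V.smult_l_distr by (intro V.finsum_cong') (auto simp: lookup_add)
  also have "\<dots> = (\<Oplus>\<^bsub>V\<^esub>w\<in>?A. ?t p w) \<oplus>\<^bsub>V\<^esub> (\<Oplus>\<^bsub>V\<^esub>w\<in>?A. ?t q w)"
    using closed by (intro V.finsum_addf) auto
  finally show ?thesis
    unfolding free_act_superset[OF A(1) sub(1) A(2) v] free_act_superset[OF A(1) sub(2) A(2) v]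
      free_act_superset[OF A(1) sub(3) A(2) v] .
qed

lemma free_act_const: "v \<in> carrier V \<Longrightarrow> free_act V act (free_const c) v = c \<odot>\<^bsub>V\<^esub> v"
  by (simp add: free_const_def free_act_single)

lemma free_act_0: "v \<in> carrier V \<Longrightarrow> free_act V act 0 v = \<zero>\<^bsub>V\<^esub>"
  by (simp add: free_act_def)

lemma free_act_1: "v \<in> carrier V \<Longrightarrow> free_act V act 1 v = v"
  using free_act_const[of v 1] V.smult_one[of v] by (simp add: free_const_1)

lemma free_act_gen:
  "\<lbrakk>x \<in> carrier L; v \<in> carrier V\<rbrakk> \<Longrightarrow> free_act V act (free_gen x) v = act x v"
  using V.smult_one[of "act x v"] by (simp add: free_gen_def free_act_single act_closed)

lemma free_act_closed:
  assumes "p \<in> carrier (free_algebra (carrier L))" "v \<in> carrier V"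
  shows "free_act V act p v \<in> carrier V"
  using assms
  by (induction rule: free_algebra_single_induct)
    (auto simp: free_act_single free_act_add_left foldr_act_closed)

lemma free_act_const_mult:
  assumes "p \<in> carrier (free_algebra (carrier L))" "v \<in> carrier V"
  shows "free_act V act (free_const c * p) v = c \<odot>\<^bsub>V\<^esub> free_act V act p v"
  using assms
proof (induction rule: free_algebra_single_induct)
  case (single w d)
  then show ?case
    by (simp add: free_act_single free_const_mult_single foldr_act_closed V.smult_assoc1[symmetric]
        del: in_lists_conv_set)
next
  case (add p q)
  then show ?case
    by (simp add: distrib_left free_act_add_left free_algebra_mult free_algebra_const
        free_act_closed V.smult_r_distr)
qed

lemma free_act_gen_mult:
  assumes "p \<in> carrier (free_algebra (carrier L))" "x \<in> carrier L" "v \<in> carrier V"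
  shows "free_act V act (free_gen x * p) v = act x (free_act V act p v)"
  using assms
proof (induction rule: free_algebra_single_induct)
  case (single w d)
  then show ?case
    by (simp add: free_act_single free_gen_mult_single foldr_act_closed act_smult_right
        del: in_lists_conv_set)
next
  case (add p q)
  then show ?case
    by (simp add: distrib_left free_act_add_left free_algebra_mult free_algebra_gen
        free_act_closed act_add_right)
qed

lemma free_act_mult:
  assumes "p \<in> carrier (free_algebra (carrier L))" "q \<in> carrier (free_algebra (carrier L))"
    "v \<in> carrier V"
  shows "free_act V act (p * q) v = free_act V act p (free_act V act q v)"
  using assms
proof (induction rule: free_algebra_induct)
  case (const c)
  then show ?case by (simp add: free_act_const_mult free_act_const free_act_closed)
next
  case (gen x p)
  then show ?case
    by (simp add: mult.assoc free_act_gen_mult free_algebra_mult free_act_closed)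
next
  case (add p p')
  then show ?case
    by (simp add: distrib_right free_act_add_left free_algebra_mult free_act_closed)
qed

lemma free_act_add_right:
  assumes "p \<in> carrier (free_algebra (carrier L))" "u \<in> carrier V" "v \<in> carrier V"
  shows "free_act V act p (u \<oplus>\<^bsub>V\<^esub> v) = free_act V act p u \<oplus>\<^bsub>V\<^esub> free_act V act p v"
  using assms
proof (induction rule: free_algebra_induct)
  case (const c)
  then show ?case by (simp add: free_act_const V.smult_r_distr)
next
  case (gen x p)
  then show ?case by (simp add: free_act_gen_mult free_act_closed act_add_right)
next
  case (add p q)
  then show ?case
    by (simp add: free_act_add_left free_act_closed V.add.m_ac)
qed

lemma free_act_smult_right:
  assumes "p \<in> carrier (free_algebra (carrier L))" "v \<in> carrier V"
  shows "free_act V act p (c \<odot>\<^bsub>V\<^esub> v) = c \<odot>\<^bsub>V\<^esub> free_act V act p v"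
  using free_act_mult[OF assms(1) free_algebra_const assms(2), of c]
    free_act_mult[OF free_algebra_const assms, of c] free_const_commute[of c p]
  by (simp add: free_act_const assms free_act_closed)

lemma free_act_0_right:
  assumes "p \<in> carrier (free_algebra (carrier L))"
  shows "free_act V act p \<zero>\<^bsub>V\<^esub> = \<zero>\<^bsub>V\<^esub>"
  using free_act_smult_right[OF assms, of "\<zero>\<^bsub>V\<^esub>" 0] V.lmult_0 free_act_closed[OF assms, of "\<zero>\<^bsub>V\<^esub>"]
  by simp

lemma act_0_right: "x \<in> carrier L \<Longrightarrow> act x \<zero>\<^bsub>V\<^esub> = \<zero>\<^bsub>V\<^esub>"
  using free_act_0_right[OF free_algebra_gen, of x] by (simp add: free_act_gen)

lemma free_act_uminus_left:
  assumes "p \<in> carrier (free_algebra (carrier L))" "v \<in> carrier V"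
  shows "free_act V act (- p) v = \<ominus>\<^bsub>V\<^esub> free_act V act p v"
proof -
  have "free_act V act (- p) v \<oplus>\<^bsub>V\<^esub> free_act V act p v = \<zero>\<^bsub>V\<^esub>"
    using free_act_add_left[OF free_algebra_uminus[OF assms(1)] assms] assms by (simp add: free_act_0)
  then show ?thesis
    using assms by (metis V.minus_equality free_act_closed free_algebra_uminus)
qed

lemma free_act_diff_left:
  assumes "p \<in> carrier (free_algebra (carrier L))" "q \<in> carrier (free_algebra (carrier L))"
    "v \<in> carrier V"
  shows "free_act V act (p - q) v = free_act V act p v \<ominus>\<^bsub>V\<^esub> free_act V act q v"
  using free_act_add_left[OF assms(1) free_algebra_uminus[OF assms(2)] assms(3)] assms
  by (simp add: free_act_uminus_left a_minus_def)

lemma ideal_annihilator: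
  "ideal {p \<in> carrier (free_algebra (carrier L)). \<forall>v\<in>carrier V. free_act V act p v = \<zero>\<^bsub>V\<^esub>}
     (free_algebra (carrier L))" (is "ideal ?I _")
proof (rule idealI[OF ring_free_algebra])
  interpret F: ring "free_algebra (carrier L)"
    by (rule ring_free_algebra)
  show "subgroup ?I (add_monoid (free_algebra (carrier L)))"
  proof (rule group.subgroupI)
    show "Group.group (add_monoid (free_algebra (carrier L)))"
      by (rule F.add.group_axioms)
    show "?I \<noteq> {}"
      using free_algebra_0 free_act_0 by auto
  next
    fix p assume p: "p \<in> ?I"
    then have "inv\<^bsub>add_monoid (free_algebra (carrier L))\<^esub> p = - p"
      using F.minus_equality[of "- p" p] by (auto simp: a_inv_def free_algebra_uminus)
    then show "inv\<^bsub>add_monoid (free_algebra (carrier L))\<^esub> p \<in> ?I"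
      using p by (auto simp: free_algebra_uminus free_act_uminus_left)
  qed (auto simp: free_algebra_add free_act_add_left)
qed (auto simp: free_algebra_mult free_act_mult free_act_0_right free_act_closed)

text \<open>The annihilator of \<open>V\<close> is a two-sided ideal, and the module axioms say that it contains the defining
relations of the enveloping algebra.\<close>
lemma free_act_env_ideal:
  assumes "p \<in> env_ideal L" "v \<in> carrier V"
  shows "free_act V act p v = \<zero>\<^bsub>V\<^esub>"
proof -
  have [simp]: "a \<ominus>\<^bsub>V\<^esub> a = \<zero>\<^bsub>V\<^esub>" if "a \<in> carrier V" for a
    using that by (simp add: a_minus_def V.r_neg)
  have "free_act V act p v = \<zero>\<^bsub>V\<^esub>" if "p \<in> env_rels L" "v \<in> carrier V" for p v
    using that(1)
  proof (unfold env_rels_def, elim UnE CollectE exE conjE)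
    fix x y assume "x \<in> carrier L" "y \<in> carrier L" "p = free_gen (x \<oplus>\<^bsub>L\<^esub> y) - free_gen x - free_gen y"
    then show ?thesis
      using that(2)
      by (simp add: diff_diff_eq free_act_diff_left free_act_add_left free_algebra_closed free_act_gen
          act_add_left act_closed)
  next
    fix c x assume "x \<in> carrier L" "p = free_gen (c \<odot>\<^bsub>L\<^esub> x) - free_const c * free_gen x"
    then show ?thesis
      using that(2)
      by (simp add: free_act_diff_left free_algebra_closed free_act_gen free_act_const_mult
          act_smult_left act_closed)
  next
    fix x y assume "x \<in> carrier L" "y \<in> carrier L"
      "p = free_gen x * free_gen y - free_gen y * free_gen x - free_gen (x \<otimes>\<^bsub>L\<^esub> y)"
    then show ?thesis
      using that(2)
      by (simp add: free_act_diff_left free_algebra_closed free_act_gen free_act_gen_mult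
          act_bracket act_closed L.bracket_closed)
  qed
  then have "env_rels L \<subseteq>
      {p \<in> carrier (free_algebra (carrier L)). \<forall>v\<in>carrier V. free_act V act p v = \<zero>\<^bsub>V\<^esub>}"
    using L.env_rels_closed by blast
  then show ?thesis
    using L.env_ideal_minimal[OF ideal_annihilator] assms by blast
qed

lemma free_act_cong:
  assumes "p \<in> carrier (free_algebra (carrier L))" "q \<in> carrier (free_algebra (carrier L))"
    "p - q \<in> env_ideal L" "v \<in> carrier V"
  shows "free_act V act p v = free_act V act q v"
  using free_act_add_left[OF assms(2) free_algebra_diff[OF assms(1,2)] assms(4)]
    free_act_env_ideal[OF assms(3,4)] assms
  by (simp add: free_act_closed)

lemma env_act_class:
  assumes "p \<in> carrier (free_algebra (carrier L))" "v \<in> carrier V"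
  shows "env_act V act (env_class L p) v = free_act V act p v"
proof -
  have "free_act V act q v = free_act V act p v" if q: "q \<in> env_class L p" for q
  proof -
    obtain r where "r \<in> env_ideal L" "q = r + p"
      using q unfolding L.env_class_alt by blast
    then show ?thesis
      using assms L.env_ideal_carrier by (intro free_act_cong) (auto intro: free_algebra_add)
  qed
  moreover have "env_class L p \<noteq> {}"
    using L.env_ideal_0 by (auto simp: L.env_class_alt)
  ultimately have "(\<lambda>q. free_act V act q v) ` env_class L p = {free_act V act p v}"
    by auto
  then show ?thesis by (simp add: env_act_def)
qed

text \<open>Sums in a submodule are formed in a different record than sums in \<open>V\<close>. The lemma allows computing in \<open>V\<close>
throughout.\<close>
lemma free_act_submodule:
  assumes E: "submodule class_ring E V" and p: "p \<in> carrier (free_algebra S)"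
    and S: "\<And>x e. \<lbrakk>x \<in> S; e \<in> E\<rbrakk> \<Longrightarrow> act x e \<in> E" and e: "e \<in> E"
  shows "free_act (V\<lparr>carrier := E\<rparr>) act p e = free_act V act p e"
proof -
  have "foldr act w e \<in> E" if "w \<in> lists S" for w
    using that by (induction w) (auto simp: S e)
  then have "(\<lambda>w. Poly_Mapping.lookup p w \<odot>\<^bsub>V\<^esub> foldr act w e) \<in> Poly_Mapping.keys p \<rightarrow> E"
    using p submodule.smult_closed[OF E] by (force simp: free_algebra_iff)
  then show ?thesis
    unfolding free_act_def using module.finsum_submodule[OF V.module_axioms E] by simp
qed

end


section \<open>Subalgebras\<close>

locale lie_subalgebra = lie_algebra L for L :: "(complex, 'g) module" (structure) +
  fixes S
  assumes submod: "submodule class_ring S L"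
    and bracket_sub: "\<lbrakk>x \<in> S; y \<in> S\<rbrakk> \<Longrightarrow> x \<otimes> y \<in> S"
begin

lemma sub_carrier: "S \<subseteq> carrier L"
  using submodule.subset[OF submod] .

lemma sub_free_algebra: "q \<in> carrier (free_algebra S) \<Longrightarrow> q \<in> carrier (free_algebra (carrier L))"
  using free_algebra_mono[OF sub_carrier] by blast

lemma lie_algebra_sub: "lie_algebra (L\<lparr>carrier := S\<rparr>)"
proof -
  interpret S: vectorspace class_ring "L\<lparr>carrier := S\<rparr>"
    by (rule subspace_is_vs[OF subspace.intro[OF vectorspace_axioms submod]])
  have [dest]: "x \<in> S \<Longrightarrow> x \<in> carrier L" for x
    using sub_carrier by blast
  show ?thesis
  proof (unfold_locales, goal_cases)
    case 1
    then show ?case by (simp add: bracket_sub)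
  next
    case (2 x y z)
    then show ?case by (auto intro: bracket_add_left)
  next
    case (3 x y)
    then show ?case by (auto intro: bracket_smult_left)
  next
    case (4 x y z)
    then show ?case by (auto intro: bracket_add_right)
  next
    case (5 x y)
    then show ?case by (auto intro: bracket_smult_right)
  next
    case (6 x)
    then show ?case by (auto intro: bracket_self)
  next
    case (7 x y z)
    then show ?case by (auto intro: jacobi)
  qed
qed

sublocale S: lie_algebra "L\<lparr>carrier := S\<rparr>"
  by (rule lie_algebra_sub)

text \<open>This inclusion makes the map from \<open>U(H)\<close> to \<open>U(L)\<close> well defined. The relations of \<open>H\<close> are relations of \<open>L\<close>,
and the ideal of \<open>L\<close> meets the free algebra on \<open>H\<close> in an ideal.\<close>
lemma env_ideal_sub: "env_ideal (L\<lparr>carrier := S\<rparr>) \<subseteq> env_ideal L"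
proof -
  let ?F = "free_algebra S"
  interpret F: ring ?F by (rule ring_free_algebra)
  have FS: "carrier ?F \<subseteq> carrier (free_algebra (carrier L))"
    by (rule free_algebra_mono[OF sub_carrier])
  have "ideal (env_ideal L \<inter> carrier ?F) ?F"
  proof (rule idealI[OF ring_free_algebra])
    show "subgroup (env_ideal L \<inter> carrier ?F) (add_monoid ?F)"
    proof (rule group.subgroupI)
      show "Group.group (add_monoid ?F)"
        by (rule F.add.group_axioms)
      show "env_ideal L \<inter> carrier ?F \<noteq> {}"
        using env_ideal_0 free_algebra_0 by auto
    next
      fix p assume p: "p \<in> env_ideal L \<inter> carrier ?F"
      then have "inv\<^bsub>add_monoid ?F\<^esub> p = - p"
        using F.minus_equality[of "- p" p] by (auto simp: a_inv_def free_algebra_uminus)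
      then show "inv\<^bsub>add_monoid ?F\<^esub> p \<in> env_ideal L \<inter> carrier ?F"
        using p by (auto simp: free_algebra_uminus env_ideal_uminus)
    qed (auto simp: free_algebra_add env_ideal_add)
  qed (use FS in \<open>auto simp: free_algebra_mult intro: env_ideal_lmult env_ideal_rmult\<close>)
  moreover have "env_rels (L\<lparr>carrier := S\<rparr>) \<subseteq> env_rels L"
    using sub_carrier unfolding env_rels_def by (simp, blast)
  ultimately show ?thesis
    using S.env_ideal_minimal[of "env_ideal L \<inter> carrier ?F"] S.env_rels_closed env_rels_in_ideal
    by auto
qed

lemma env_incl_class: "env_incl L (env_class (L\<lparr>carrier := S\<rparr>) p) = env_class L p"
proof -
  have "env_class L q = env_class L p" if "q \<in> env_class (L\<lparr>carrier := S\<rparr>) p" for q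
    using that env_ideal_sub by (auto simp: S.env_class_alt env_class_eq_iff)
  moreover have "env_class (L\<lparr>carrier := S\<rparr>) p \<noteq> {}"
    using S.env_ideal_0 by (auto simp: S.env_class_alt)
  ultimately have "env_class L ` env_class (L\<lparr>carrier := S\<rparr>) p = {env_class L p}"
    by auto
  then show ?thesis by (simp add: env_incl_def)
qed

end

text \<open>The action of \<open>U(H)\<close> on a stable subspace \<open>E\<close> is the action of \<open>U(L)\<close> on \<open>V\<close>, read in \<open>E\<close>. It is independent
of representatives because the ideal of \<open>H\<close> lies in that of \<open>L\<close>.\<close>
lemma (in lie_module) env_act_sub_class:
  assumes L: "lie_subalgebra L S" and E: "submodule class_ring E V"
    and S: "\<And>x e. \<lbrakk>x \<in> S; e \<in> E\<rbrakk> \<Longrightarrow> act x e \<in> E"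
    and p: "p \<in> carrier (free_algebra S)" and e: "e \<in> E"
  shows "env_act (V\<lparr>carrier := E\<rparr>) act (env_class (L\<lparr>carrier := S\<rparr>) p) e = free_act V act p e"
proof -
  interpret S: lie_subalgebra L S by (rule L)
  let ?H = "L\<lparr>carrier := S\<rparr>"
  have sub: "carrier (free_algebra S) \<subseteq> carrier (free_algebra (carrier L))"
    by (rule free_algebra_mono[OF S.sub_carrier])
  have eV: "e \<in> carrier V"
    using e submodule.subset[OF E] by blast
  have "free_act (V\<lparr>carrier := E\<rparr>) act q e = free_act V act p e" if q: "q \<in> env_class ?H p" for q
  proof -
    obtain r where r: "r \<in> env_ideal ?H" "q = r + p"
      using q unfolding S.S.env_class_alt by blast
    then have "q \<in> carrier (free_algebra S)" "q - p \<in> env_ideal L"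
      using p S.S.env_ideal_carrier[OF r(1)] S.env_ideal_sub by (auto intro: free_algebra_add)
    then show ?thesis
      using free_act_submodule[OF E _ S e] free_act_cong[of q p e] p eV sub by auto
  qed
  moreover have "env_class ?H p \<noteq> {}"
    using S.S.env_ideal_0 by (auto simp: S.S.env_class_alt)
  ultimately have "(\<lambda>q. free_act (V\<lparr>carrier := E\<rparr>) act q e) ` env_class ?H p = {free_act V act p e}"
    by auto
  then show ?thesis by (simp add: env_act_def)
qed

section \<open>Transport of module structures\<close>

text \<open>Only the operations of \<open>W\<close> have to match those of \<open>V\<close>: each axiom for \<open>W\<close> is the image under \<open>f\<close> of the same
axiom for \<open>V\<close>.\<close>
lemma lie_module_iso_transport:
  assumes V: "lie_module L V act" and f: "bij_betw f (carrier V) (carrier W)"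
    and zero: "f \<zero>\<^bsub>V\<^esub> = \<zero>\<^bsub>W\<^esub>"
    and add: "\<And>u v. \<lbrakk>u \<in> carrier V; v \<in> carrier V\<rbrakk> \<Longrightarrow> f (u \<oplus>\<^bsub>V\<^esub> v) = f u \<oplus>\<^bsub>W\<^esub> f v"
    and smult: "\<And>c v. v \<in> carrier V \<Longrightarrow> f (c \<odot>\<^bsub>V\<^esub> v) = c \<odot>\<^bsub>W\<^esub> f v"
    and act: "\<And>x v. \<lbrakk>x \<in> carrier L; v \<in> carrier V\<rbrakk> \<Longrightarrow> f (act x v) = act' x (f v)"
  shows "lie_module_iso L V act W act'"
proof -
  interpret V: lie_module L V act by (rule V)
  have W: "carrier W = f ` carrier V"
    using f by (simp add: bij_betw_def)
  have sm: "(a * b) \<odot>\<^bsub>V\<^esub> v = a \<odot>\<^bsub>V\<^esub> (b \<odot>\<^bsub>V\<^esub> v)" "1 \<odot>\<^bsub>V\<^esub> v = v"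
    "(a + b) \<odot>\<^bsub>V\<^esub> v = (a \<odot>\<^bsub>V\<^esub> v) \<oplus>\<^bsub>V\<^esub> (b \<odot>\<^bsub>V\<^esub> v)" "a \<odot>\<^bsub>V\<^esub> v \<in> carrier V"
    if "v \<in> carrier V" for a b v
    using that V.V.smult_assoc1[of a b v] V.V.smult_one[of v]
      V.V.smult_l_distr[of a b v] V.V.smult_closed[of a v] by simp_all
  have sm': "a \<odot>\<^bsub>V\<^esub> (u \<oplus>\<^bsub>V\<^esub> v) = (a \<odot>\<^bsub>V\<^esub> u) \<oplus>\<^bsub>V\<^esub> (a \<odot>\<^bsub>V\<^esub> v)"
    if "u \<in> carrier V" "v \<in> carrier V" for a u v
    using that V.V.smult_r_distr[of a u v] by simp
  note [simp] = W add[symmetric] smult[symmetric] act[symmetric] zero[symmetric] sm sm' V.V.a_ac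
  interpret W: vectorspace class_ring W
  proof (rule vs_criteria)
    show "field (class_ring :: complex ring)"
      by (rule vectorspace.axioms(2)[OF V.V.vectorspace_axioms])
    show "\<zero>\<^bsub>W\<^esub> \<in> carrier W" by simp
    show "\<forall>v w. v \<in> carrier W \<and> w \<in> carrier W \<longrightarrow> v \<oplus>\<^bsub>W\<^esub> w \<in> carrier W"
      by clarsimp
    show "\<forall>v\<in>carrier W. \<exists>neg_v\<in>carrier W. v \<oplus>\<^bsub>W\<^esub> neg_v = \<zero>\<^bsub>W\<^esub>"
      by clarsimp (metis V.V.a_inv_closed V.V.r_neg add zero)
  show "\<forall>v w. v \<in> carrier W \<and> w \<in> carrier W \<longrightarrow> v \<oplus>\<^bsub>W\<^esub> w = w \<oplus>\<^bsub>W\<^esub> v"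
      by clarsimp
  show "\<forall>v\<in>carrier W. v \<oplus>\<^bsub>W\<^esub> \<zero>\<^bsub>W\<^esub> = v"
      by clarsimp
  show "\<forall>v\<in>carrier W. \<one>\<^bsub>class_ring\<^esub> \<odot>\<^bsub>W\<^esub> v = v"
      by clarsimp
  show "\<forall>c v. c \<in> carrier class_ring \<and> v \<in> carrier W \<longrightarrow> c \<odot>\<^bsub>W\<^esub> v \<in> carrier W"
      by clarsimp
  show "\<forall>a v w. a \<in> carrier class_ring \<and> v \<in> carrier W \<and> w \<in> carrier W \<longrightarrow>
        a \<odot>\<^bsub>W\<^esub> (v \<oplus>\<^bsub>W\<^esub> w) = (a \<odot>\<^bsub>W\<^esub> v) \<oplus>\<^bsub>W\<^esub> (a \<odot>\<^bsub>W\<^esub> w)"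
      by clarsimp
  show "\<forall>a b v. a \<in> carrier class_ring \<and> b \<in> carrier class_ring \<and> v \<in> carrier W \<longrightarrow>
        (a \<oplus>\<^bsub>class_ring\<^esub> b) \<odot>\<^bsub>W\<^esub> v = (a \<odot>\<^bsub>W\<^esub> v) \<oplus>\<^bsub>W\<^esub> (b \<odot>\<^bsub>W\<^esub> v)"
      by clarsimp
  show "\<forall>v w x. v \<in> carrier W \<and> w \<in> carrier W \<and> x \<in> carrier W \<longrightarrow>
        (v \<oplus>\<^bsub>W\<^esub> w) \<oplus>\<^bsub>W\<^esub> x = v \<oplus>\<^bsub>W\<^esub> (w \<oplus>\<^bsub>W\<^esub> x)"
      by clarsimp
  show "\<forall>a b v. a \<in> carrier class_ring \<and> b \<in> carrier class_ring \<and> v \<in> carrier W \<longrightarrow>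
        (a \<otimes>\<^bsub>class_ring\<^esub> b) \<odot>\<^bsub>W\<^esub> v = a \<odot>\<^bsub>W\<^esub> (b \<odot>\<^bsub>W\<^esub> v)"
      by clarsimp
  qed
  have lin: "linear_map class_ring V W f"
    by unfold_locales (unfold LinearCombinations.module_hom_def, clarsimp)
  have minus: "f u \<ominus>\<^bsub>W\<^esub> f v = f (u \<ominus>\<^bsub>V\<^esub> v)" if "u \<in> carrier V" "v \<in> carrier V" for u v
    by (rule linear_map.T_minus[OF lin that, symmetric])
  have "lie_module L W act'"
    by unfold_locales (clarsimp simp: V.act_closed V.act_add_left V.act_smult_left V.act_add_right
        V.act_smult_right V.act_bracket V.L.bracket_closed minus)+
  then show ?thesis
    unfolding lie_module_iso_def using V lin f act by blast
qed


section \<open>The canonical map from an induced module\<close>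

text \<open>The setting is an \<open>L\<close>-module \<open>V\<close> with a subspace \<open>E\<close> that is stable under a subalgebra \<open>S\<close>. Frobenius
reciprocity gives a canonical map from \<open>U(L) \<otimes>\<^bsub>U(S)\<^esub> E\<close> to \<open>V\<close>, which is studied on the level of formal sums
of pairs.\<close>

locale lie_induction = lie_module L V act + sub: lie_subalgebra L S
  for L :: "(complex, 'g) module" (structure) and V :: "(complex, 'v) module" (structure)
    and act :: "'g \<Rightarrow> 'v \<Rightarrow> 'v" and S :: "'g set" +
  fixes E :: "'v set"
  assumes submod_E: "submodule class_ring E V"
    and stable_E: "\<lbrakk>x \<in> S; e \<in> E\<rbrakk> \<Longrightarrow> act x e \<in> E"
begin

abbreviation "algL \<equiv> carrier (free_algebra (carrier L))"
abbreviation "algS \<equiv> carrier (free_algebra S)"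
abbreviation "cl \<equiv> env_class L"
abbreviation "frags \<equiv> free_Abelian_group (carrier (env_alg L) \<times> E)"
abbreviation "ker \<equiv> ind_kernel L (L\<lparr>carrier := S\<rparr>) (V\<lparr>carrier := E\<rparr>) act"
abbreviation "rels \<equiv> tensor_rels (env_alg (L\<lparr>carrier := S\<rparr>)) (env_alg L)
  (\<lambda>u h. u \<otimes>\<^bsub>env_alg L\<^esub> env_incl L h) (V\<lparr>carrier := E\<rparr>) (env_act (V\<lparr>carrier := E\<rparr>) act)"

lemma E_carrier: "e \<in> E \<Longrightarrow> e \<in> carrier V"
  using submodule.subset[OF submod_E] by blast

lemmas algS_algL = sub.sub_free_algebra

lemma free_act_stable: "\<lbrakk>q \<in> algS; e \<in> E\<rbrakk> \<Longrightarrow> free_act V act q e \<in> E"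
proof (induction arbitrary: e rule: free_algebra_induct)
  case (const c)
  then show ?case
    using submodule.smult_closed[OF submod_E, of c e] by (simp add: free_act_const E_carrier)
next
  case (gen x q)
  moreover from this have "x \<in> carrier L"
    using sub.sub_carrier by blast
  ultimately show ?case
    by (simp add: free_act_gen_mult algS_algL E_carrier stable_E)
next
  case (add p q)
  then show ?case
    using submodule.m_closed[OF submod_E] by (simp add: free_act_add_left algS_algL E_carrier)
qed

lemma class_in_env_alg: "p \<in> algL \<Longrightarrow> cl p \<in> carrier (env_alg L)"
  by (simp add: L.carrier_env_alg)

lemma env_act_E:
  "\<lbrakk>q \<in> algS; e \<in> E\<rbrakk> \<Longrightarrow>
    env_act (V\<lparr>carrier := E\<rparr>) act (env_class (L\<lparr>carrier := S\<rparr>) q) e = free_act V act q e"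
  by (rule env_act_sub_class[OF sub.lie_subalgebra_axioms submod_E stable_E])

text \<open>All classes in the enveloping algebras have representatives in a free algebra, and on representatives the
relations no longer mention \<open>U(S)\<close>.\<close>
lemma tensor_rels_eq:
  "rels =
     {frag_of (cl (p + q), e) - frag_of (cl p, e) - frag_of (cl q, e) | p q e.
        p \<in> algL \<and> q \<in> algL \<and> e \<in> E} \<union>
     {frag_of (cl p, e \<oplus>\<^bsub>V\<^esub> e') - frag_of (cl p, e) - frag_of (cl p, e') | p e e'.
        p \<in> algL \<and> e \<in> E \<and> e' \<in> E} \<union>
     {frag_of (cl (p * q), e) - frag_of (cl p, free_act V act q e) | p q e.
        p \<in> algL \<and> q \<in> algS \<and> e \<in> E}" (is "_ = ?A \<union> ?B \<union> ?C")
proof -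
  let ?H = "L\<lparr>carrier := S\<rparr>"
  have "{frag_of (m \<oplus>\<^bsub>env_alg L\<^esub> m', n) - frag_of (m, n) - frag_of (m', n) | m m' n.
        m \<in> carrier (env_alg L) \<and> m' \<in> carrier (env_alg L) \<and> n \<in> E} = ?A" (is "?A' = _")
  proof (intro equalityI subsetI)
    show "z \<in> ?A" if "z \<in> ?A'" for z
      using that by (clarsimp simp: L.carrier_env_alg L.env_alg_add) blast
    show "z \<in> ?A'" if "z \<in> ?A" for z
    proof -
      obtain p q e where pq: "p \<in> algL" "q \<in> algL" "e \<in> E"
        and z: "z = frag_of (cl (p + q), e) - frag_of (cl p, e) - frag_of (cl q, e)"
        using \<open>z \<in> ?A\<close> by blast
      from pq show ?thesis
        by (intro CollectI exI[of _ "cl p"] exI[of _ "cl q"] exI[of _ e])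
          (simp add: z L.env_alg_add class_in_env_alg)
    qed
  qed
  moreover have "{frag_of (m, n \<oplus>\<^bsub>V\<^esub> n') - frag_of (m, n) - frag_of (m, n') | m n n'.
        m \<in> carrier (env_alg L) \<and> n \<in> E \<and> n' \<in> E} = ?B"
    unfolding L.carrier_env_alg by blast
  moreover have "{frag_of (m \<otimes>\<^bsub>env_alg L\<^esub> env_incl L r, n)
        - frag_of (m, env_act (V\<lparr>carrier := E\<rparr>) act r n) | m r n.
        m \<in> carrier (env_alg L) \<and> r \<in> carrier (env_alg ?H) \<and> n \<in> E} = ?C" (is "?C' = _")
  proof (intro equalityI subsetI)
    show "z \<in> ?C" if "z \<in> ?C'" for z
      using that by (clarsimp simp: L.carrier_env_alg sub.S.carrier_env_alg L.env_alg_mult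
          sub.env_incl_class env_act_E algS_algL) blast
    show "z \<in> ?C'" if "z \<in> ?C" for z
    proof -
      obtain p q e where pq: "p \<in> algL" "q \<in> algS" "e \<in> E"
        and z: "z = frag_of (cl (p * q), e) - frag_of (cl p, free_act V act q e)"
        using \<open>z \<in> ?C\<close> by blast
      from pq show ?thesis
        by (intro CollectI exI[of _ "cl p"] exI[of _ "env_class ?H q"] exI[of _ e])
          (simp add: z L.env_alg_mult class_in_env_alg sub.env_incl_class env_act_E algS_algL
            sub.S.carrier_env_alg)
    qed
  qed
  ultimately show ?thesis
    unfolding tensor_rels_def by simp
qed

lemma frag_of_frags: "\<lbrakk>p \<in> algL; e \<in> E\<rbrakk> \<Longrightarrow> frag_of (cl p, e) \<in> carrier frags"
  by (simp add: class_in_env_alg)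

lemma frags_0: "0 \<in> carrier frags"
  and frags_add: "\<lbrakk>y \<in> carrier frags; z \<in> carrier frags\<rbrakk> \<Longrightarrow> y + z \<in> carrier frags"
  and frags_diff: "\<lbrakk>y \<in> carrier frags; z \<in> carrier frags\<rbrakk> \<Longrightarrow> y - z \<in> carrier frags"
  using keys_add[of y z] keys_diff[of y z] by auto

lemma tensor_rels_frags: "rels \<subseteq> carrier frags"
  unfolding tensor_rels_eq
  using submodule.m_closed[OF submod_E]
  by (auto simp del: carrier_free_Abelian_group_iff simp: free_act_stable
      intro!: frags_diff frag_of_frags free_algebra_closed intro: algS_algL)

lemma ker_eq: "ker = generate frags rels"
  by (simp add: ind_kernel_def tensor_kernel_def)

lemma subgroup_ker: "subgroup ker frags"
  unfolding ker_eq by (rule group.generate_is_subgroup[OF group_free_Abelian_group tensor_rels_frags])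

lemma ker_frags: "z \<in> ker \<Longrightarrow> z \<in> carrier frags"
  using subgroup.mem_carrier[OF subgroup_ker] .

lemma ker_add: "\<lbrakk>y \<in> ker; z \<in> ker\<rbrakk> \<Longrightarrow> y + z \<in> ker"
  using subgroup.m_closed[OF subgroup_ker] by simp

lemma ker_uminus: "z \<in> ker \<Longrightarrow> - z \<in> ker"
  using subgroup.m_inv_closed[OF subgroup_ker, of z] ker_frags[of z] by simp

lemma ker_diff: "\<lbrakk>y \<in> ker; z \<in> ker\<rbrakk> \<Longrightarrow> y - z \<in> ker"
  using ker_add[of y "- z"] ker_uminus[of z] by simp

lemma rels_ker: "rels \<subseteq> ker"
  unfolding ker_eq by (auto intro: generate.incl)

lemma ker_tensor_add_left:
  "\<lbrakk>p \<in> algL; q \<in> algL; e \<in> E\<rbrakk> \<Longrightarrow>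
    frag_of (cl (p + q), e) - frag_of (cl p, e) - frag_of (cl q, e) \<in> ker"
  by (rule subsetD[OF rels_ker], unfold tensor_rels_eq) blast

lemma ker_tensor_add_right:
  "\<lbrakk>p \<in> algL; e \<in> E; e' \<in> E\<rbrakk> \<Longrightarrow>
    frag_of (cl p, e \<oplus>\<^bsub>V\<^esub> e') - frag_of (cl p, e) - frag_of (cl p, e') \<in> ker"
  by (rule subsetD[OF rels_ker], unfold tensor_rels_eq) blast

lemma ker_tensor_balanced:
  "\<lbrakk>p \<in> algL; q \<in> algS; e \<in> E\<rbrakk> \<Longrightarrow>
    frag_of (cl (p * q), e) - frag_of (cl p, free_act V act q e) \<in> ker"
  by (rule subsetD[OF rels_ker], unfold tensor_rels_eq) blast

lemma ker_tensor_0_left: "e \<in> E \<Longrightarrow> frag_of (cl 0, e) \<in> ker"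
  using ker_tensor_add_left[OF free_algebra_0 free_algebra_0, of e] ker_uminus by force

lemma ker_tensor_0_right: "p \<in> algL \<Longrightarrow> frag_of (cl p, \<zero>\<^bsub>V\<^esub>) \<in> ker"
  using ker_tensor_add_right[of p "\<zero>\<^bsub>V\<^esub>" "\<zero>\<^bsub>V\<^esub>"] submodule.zero_closed[OF submod_E] ker_uminus
  by force

text \<open>This is \<open>p q \<otimes> e = p \<otimes> q e\<close>. It is how elements of the kernel of the canonical map are recognised as tensor
relations.\<close>
lemma ker_tensor_annihilated:
  assumes "p \<in> algL" "q \<in> algS" "e \<in> E" "free_act V act q e = \<zero>\<^bsub>V\<^esub>"
  shows "frag_of (cl (p * q), e) \<in> ker"
  using ker_add[OF ker_tensor_balanced[OF assms(1-3)] ker_tensor_0_right[OF assms(1)]] assms(4) by simp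

lemma ker_tensor_sum:
  assumes "finite A" "e \<in> E" "\<And>i. i \<in> A \<Longrightarrow> p i \<in> algL" "\<And>i. i \<in> A \<Longrightarrow> frag_of (cl (p i), e) \<in> ker"
  shows "frag_of (cl (sum p A), e) \<in> ker"
  using assms
proof (induction A rule: finite_induct)
  case empty
  then show ?case by (simp add: ker_tensor_0_left)
next
  case (insert i A)
  have "frag_of (cl (p i + sum p A), e) - frag_of (cl (p i), e) - frag_of (cl (sum p A), e) \<in> ker"
    using insert by (intro ker_tensor_add_left free_algebra_sum) auto
  moreover have "frag_of (cl (p i), e) \<in> ker" "frag_of (cl (sum p A), e) \<in> ker"
    using insert by auto
  ultimately show ?case
    using insert(1,2) ker_add[OF ker_add[of _ "frag_of (cl (p i), e)"], of _ "frag_of (cl (sum p A), e)"]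
    by force
qed

text \<open>The homomorphism with \<open>(u, e) \<mapsto> u e\<close>; it exists by the universal property of the free abelian group.\<close>
definition ind_eval :: "(('g list \<Rightarrow>\<^sub>0 complex) set \<times> 'v \<Rightarrow>\<^sub>0 int) \<Rightarrow> 'v" where
  "ind_eval = (SOME h. h \<in> hom frags (add_monoid V) \<and>
     (\<forall>u\<in>carrier (env_alg L). \<forall>e\<in>E. h (frag_of (u, e)) = env_act V act u e))"

lemma ind_eval_hom: "ind_eval \<in> hom frags (add_monoid V)"
  and ind_eval_frag_of: "\<lbrakk>p \<in> algL; e \<in> E\<rbrakk> \<Longrightarrow> ind_eval (frag_of (cl p, e)) = free_act V act p e"
proof -
  have "(\<lambda>(u, e). env_act V act u e) ` (carrier (env_alg L) \<times> E) \<subseteq> carrier (add_monoid V)"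
    by (auto simp: L.carrier_env_alg env_act_class E_carrier free_act_closed)
  then obtain h where "h \<in> hom frags (add_monoid V)"
    "\<And>x. x \<in> carrier (env_alg L) \<times> E \<Longrightarrow> h (frag_of x) = (\<lambda>(u, e). env_act V act u e) x"
    using comm_group.free_Abelian_group_universal[OF V.a_comm_group] by blast
  then have "\<exists>h. h \<in> hom frags (add_monoid V) \<and>
     (\<forall>u\<in>carrier (env_alg L). \<forall>e\<in>E. h (frag_of (u, e)) = env_act V act u e)"
    by fastforce
  then have *: "ind_eval \<in> hom frags (add_monoid V) \<and>
     (\<forall>u\<in>carrier (env_alg L). \<forall>e\<in>E. ind_eval (frag_of (u, e)) = env_act V act u e)"
    unfolding ind_eval_def by (rule someI_ex)
  then show "ind_eval \<in> hom frags (add_monoid V)" ..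
  show "ind_eval (frag_of (cl p, e)) = free_act V act p e" if "p \<in> algL" "e \<in> E"
    using * that by (simp add: class_in_env_alg env_act_class E_carrier)
qed

lemma ind_eval_closed: "z \<in> carrier frags \<Longrightarrow> ind_eval z \<in> carrier V"
  using hom_in_carrier[OF ind_eval_hom] by simp

lemma ind_eval_add:
  "\<lbrakk>y \<in> carrier frags; z \<in> carrier frags\<rbrakk> \<Longrightarrow> ind_eval (y + z) = ind_eval y \<oplus>\<^bsub>V\<^esub> ind_eval z"
  using hom_mult[OF ind_eval_hom] by simp

lemma ind_eval_0: "ind_eval 0 = \<zero>\<^bsub>V\<^esub>"
  using hom_one[OF ind_eval_hom] V.a_comm_group comm_group.axioms(2) by fastforce

lemma ind_eval_diff:
  assumes "y \<in> carrier frags" "z \<in> carrier frags"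
  shows "ind_eval (y - z) = ind_eval y \<ominus>\<^bsub>V\<^esub> ind_eval z"
proof -
  have "ind_eval y = ind_eval (y - z) \<oplus>\<^bsub>V\<^esub> ind_eval z"
    using ind_eval_add[OF frags_diff[OF assms] assms(2)] by simp
  then show ?thesis
    using ind_eval_closed assms frags_diff[OF assms] by (simp add: a_minus_def V.a_assoc V.r_neg)
qed

lemma ind_eval_ker:
  assumes "z \<in> ker"
  shows "ind_eval z = \<zero>\<^bsub>V\<^esub>"
proof -
  interpret F: group_hom frags "add_monoid V" ind_eval
    by (intro group_hom.intro group_hom_axioms.intro ind_eval_hom group_free_Abelian_group V.a_group)
  have [simp]: "a \<ominus>\<^bsub>V\<^esub> a = \<zero>\<^bsub>V\<^esub>" if "a \<in> carrier V" for a
    using that by (simp add: a_minus_def V.r_neg)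
  have [simp]: "a \<oplus>\<^bsub>V\<^esub> b \<ominus>\<^bsub>V\<^esub> a = b" if "a \<in> carrier V" "b \<in> carrier V" for a b
    using that by (simp add: a_minus_def V.r_neg V.a_assoc V.a_comm[of a])
  have "rels \<subseteq> kernel frags (add_monoid V) ind_eval"
  proof
    fix z assume "z \<in> rels"
    then have "ind_eval z = \<zero>\<^bsub>V\<^esub>"
      unfolding tensor_rels_eq
    proof (elim UnE CollectE exE conjE)
      fix p q e assume "p \<in> algL" "q \<in> algL" "e \<in> E"
        and z: "z = frag_of (cl (p + q), e) - frag_of (cl p, e) - frag_of (cl q, e)"
      then show ?thesis
        by (simp del: carrier_free_Abelian_group_iff add: z ind_eval_diff frags_diff frag_of_frags class_in_env_alg
            free_algebra_closed ind_eval_frag_of free_act_add_left E_carrier free_act_closed)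
    next
      fix p e e' assume "p \<in> algL" "e \<in> E" "e' \<in> E"
        and z: "z = frag_of (cl p, e \<oplus>\<^bsub>V\<^esub> e') - frag_of (cl p, e) - frag_of (cl p, e')"
      then show ?thesis
        using submodule.m_closed[OF submod_E]
        by (simp del: carrier_free_Abelian_group_iff add: z ind_eval_diff frags_diff frag_of_frags class_in_env_alg
            ind_eval_frag_of free_act_add_right E_carrier free_act_closed)
    next
      fix p q e assume "p \<in> algL" "q \<in> algS" "e \<in> E"
        and z: "z = frag_of (cl (p * q), e) - frag_of (cl p, free_act V act q e)"
      then show ?thesis
        by (simp del: carrier_free_Abelian_group_iff add: z ind_eval_diff frag_of_frags class_in_env_alg algS_algL
            free_algebra_closed ind_eval_frag_of free_act_mult E_carrier free_act_closed free_act_stable)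
    qed
    then show "z \<in> kernel frags (add_monoid V) ind_eval"
      using \<open>z \<in> rels\<close> tensor_rels_frags
      by (auto simp del: carrier_free_Abelian_group_iff simp: kernel_def)
  qed
  then have "ker \<subseteq> kernel frags (add_monoid V) ind_eval"
    unfolding ker_eq
    by (rule group.generate_subgroup_incl[OF group_free_Abelian_group _ F.subgroup_kernel])
  then show ?thesis
    using assms by (auto simp: kernel_def)
qed

abbreviation "lmult u \<equiv> frag_extend (\<lambda>(u', e). frag_of (u \<otimes>\<^bsub>env_alg L\<^esub> u', e))"

lemma ind_eval_lmult:
  assumes p: "p \<in> algL" and z: "z \<in> carrier frags"
  shows "lmult (cl p) z \<in> carrier frags \<and> ind_eval (lmult (cl p) z) = free_act V act p (ind_eval z)"
proof -
  have "Poly_Mapping.keys z \<subseteq> carrier (env_alg L) \<times> E"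
    using z by simp
  then show ?thesis
  proof (induction z rule: free_Abelian_group_induct[consumes 1, case_names zero diff gen])
    case zero
    then show ?case using p frags_0 by (simp add: ind_eval_0 free_act_0_right)
  next
    case (diff x y)
    then have xy: "x \<in> carrier frags" "y \<in> carrier frags" "x - y \<in> carrier frags"
      using frags_diff[of x y] by simp_all
    have "ind_eval x = ind_eval (x - y) \<oplus>\<^bsub>V\<^esub> ind_eval y"
      using ind_eval_add[OF xy(3,2)] by simp
    then have "free_act V act p (ind_eval x)
        = free_act V act p (ind_eval (x - y)) \<oplus>\<^bsub>V\<^esub> free_act V act p (ind_eval y)"
      using free_act_add_right[OF p] xy by (simp add: ind_eval_closed)
    then show ?case
      using diff xy p frags_diff[of "lmult (cl p) x" "lmult (cl p) y"]
      by (simp del: carrier_free_Abelian_group_iff add: frag_extend_diff ind_eval_diff ind_eval_closed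
          free_act_closed a_minus_def V.a_assoc V.r_neg)
  next
    case (gen a)
    then obtain q e where "a = (cl q, e)" "q \<in> algL" "e \<in> E"
      by (auto simp: L.carrier_env_alg)
    then show ?case
      using p by (simp del: carrier_free_Abelian_group_iff add: L.env_alg_mult frag_of_frags class_in_env_alg
          free_algebra_closed ind_eval_frag_of free_act_mult E_carrier)
  qed
qed

text \<open>Under these two hypotheses the cosets of the relations are the fibres of the evaluation map, so
\<open>v \<mapsto> {z. ind_eval z = v}\<close> is a bijection onto the induced module. That left multiplication is well defined
on cosets comes for free: it maps fibres to fibres.\<close>
theorem induced_module_iso:
  assumes inj: "\<And>z. \<lbrakk>z \<in> carrier frags; ind_eval z = \<zero>\<^bsub>V\<^esub>\<rbrakk> \<Longrightarrow> z \<in> ker"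
    and surj: "\<And>v. v \<in> carrier V \<Longrightarrow> \<exists>z\<in>carrier frags. ind_eval z = v"
  shows "lie_module_iso L V act (induced_module L (L\<lparr>carrier := S\<rparr>) (V\<lparr>carrier := E\<rparr>) act)
    (induced_act L (L\<lparr>carrier := S\<rparr>) (V\<lparr>carrier := E\<rparr>) act)"
proof -
  let ?H = "L\<lparr>carrier := S\<rparr>" and ?E = "V\<lparr>carrier := E\<rparr>"
  define f where "f v = {z \<in> carrier frags. ind_eval z = v}" for v
  have group: "ind_group L ?H ?E act = frags Mod ker"
    by (simp add: ind_group_def tensor_product_def ind_kernel_def)
  have fib: "f (ind_eval z) = ker #>\<^bsub>frags\<^esub> z" if z: "z \<in> carrier frags" for z
  proof (intro equalityI subsetI)
    fix y assume "y \<in> f (ind_eval z)"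
    then have "y - z \<in> ker"
      using z frags_diff[of y z]
      by (intro inj) (auto simp del: carrier_free_Abelian_group_iff simp: f_def ind_eval_diff
          ind_eval_closed a_minus_def V.r_neg)
    then show "y \<in> ker #>\<^bsub>frags\<^esub> z"
      by (auto simp: r_coset_def intro!: bexI[of _ "y - z"])
  next
    fix y assume "y \<in> ker #>\<^bsub>frags\<^esub> z"
    then obtain k where "k \<in> ker" "y = k + z" by (auto simp: r_coset_def)
    then show "y \<in> f (ind_eval z)"
      using z by (simp del: carrier_free_Abelian_group_iff add: f_def ker_frags frags_add
          ind_eval_add ind_eval_ker ind_eval_closed)
  qed
  have fib': "\<exists>z\<in>carrier frags. ind_eval z = v \<and> f v = ker #>\<^bsub>frags\<^esub> z" if "v \<in> carrier V" for v
    using surj[OF that] fib by blast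
  have lm: "ind_lmult L ?H ?E act (cl p) (f v) = f (free_act V act p v)"
    if p: "p \<in> algL" and v: "v \<in> carrier V" for p v
  proof -
    have "ker #>\<^bsub>frags\<^esub> lmult (cl p) z = f (free_act V act p v)" if "z \<in> f v" for z
      using that fib[of "lmult (cl p) z"] ind_eval_lmult[OF p, of z]
      by (simp del: carrier_free_Abelian_group_iff add: f_def)
    moreover have "f v \<noteq> {}"
      using surj[OF v] unfolding f_def by blast
    ultimately have "(\<lambda>z. ker #>\<^bsub>frags\<^esub> lmult (cl p) z) ` f v = {f (free_act V act p v)}"
      by auto
    then show ?thesis
      by (simp add: ind_lmult_def)
  qed
  have normal: "ker \<lhd> frags"
    by (rule comm_group.subgroup_imp_normal[OF abelian_free_Abelian_group subgroup_ker])
  show ?thesis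
  proof (rule lie_module_iso_transport)
    show "lie_module L V act" by (rule lie_module_axioms)
    have "inj_on f (carrier V)"
    proof (rule inj_onI)
      fix u v assume "u \<in> carrier V" "v \<in> carrier V" "f u = f v"
      then show "u = v" using surj[of u] unfolding f_def by blast
    qed
    moreover have "f ` carrier V = rcosets\<^bsub>frags\<^esub> ker"
    proof (intro equalityI subsetI)
      fix T assume "T \<in> f ` carrier V"
      then show "T \<in> rcosets\<^bsub>frags\<^esub> ker"
        using fib' unfolding RCOSETS_def by blast
    next
      fix T assume "T \<in> rcosets\<^bsub>frags\<^esub> ker"
      then obtain z where "z \<in> carrier frags" "T = ker #>\<^bsub>frags\<^esub> z"
        unfolding RCOSETS_def by blast
      then show "T \<in> f ` carrier V"
        using fib ind_eval_closed by blast
    qed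
    ultimately show "bij_betw f (carrier V) (carrier (induced_module L ?H ?E act))"
      by (simp add: bij_betw_def induced_module_def group FactGroup_def)
    have "f \<zero>\<^bsub>V\<^esub> = ker"
      using fib[OF frags_0] ind_eval_0
        group.coset_mult_one[OF group_free_Abelian_group, of ker] subgroup.subset[OF subgroup_ker]
      by simp
    then show "f \<zero>\<^bsub>V\<^esub> = \<zero>\<^bsub>induced_module L ?H ?E act\<^esub>"
      by (simp add: induced_module_def group FactGroup_def)
    show "f (u \<oplus>\<^bsub>V\<^esub> v) = f u \<oplus>\<^bsub>induced_module L ?H ?E act\<^esub> f v"
      if u: "u \<in> carrier V" and v: "v \<in> carrier V" for u v
    proof -
      obtain y z where y: "y \<in> carrier frags" "ind_eval y = u" "f u = ker #>\<^bsub>frags\<^esub> y"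
        and z: "z \<in> carrier frags" "ind_eval z = v" "f v = ker #>\<^bsub>frags\<^esub> z"
        using fib'[OF u] fib'[OF v] by blast
      have "f u <#>\<^bsub>frags\<^esub> f v = ker #>\<^bsub>frags\<^esub> (y + z)"
        using normal.rcos_sum[OF normal y(1) z(1)] y(3) z(3) by simp
      also have "\<dots> = f (u \<oplus>\<^bsub>V\<^esub> v)"
        using fib[OF frags_add[OF y(1) z(1)]] ind_eval_add[OF y(1) z(1)] y(2) z(2) by simp
      finally show ?thesis
        by (simp add: induced_module_def group FactGroup_def)
    qed
    show "f (c \<odot>\<^bsub>V\<^esub> v) = c \<odot>\<^bsub>induced_module L ?H ?E act\<^esub> f v" if "v \<in> carrier V" for c v
      using lm[OF free_algebra_const that, of c] that by (simp add: induced_module_def free_act_const)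
    show "f (act x v) = induced_act L ?H ?E act x (f v)" if "x \<in> carrier L" "v \<in> carrier V" for x v
      using lm[OF free_algebra_gen that(2), of x] that by (simp add: induced_act_def free_act_gen)
  qed
qed

text \<open>If \<open>E = U(S) v\<close>, then \<open>p \<otimes> q v = p q \<otimes> v\<close>, so every tensor is a pure tensor with second factor \<open>v\<close> and
injectivity has to be checked on these only.\<close>
lemma induced_module_iso_cyclic:
  assumes v: "v \<in> E" and cyclic: "\<And>e. e \<in> E \<Longrightarrow> \<exists>q\<in>algS. e = free_act V act q v"
    and gen: "\<And>w. w \<in> carrier V \<Longrightarrow> \<exists>p\<in>algL. w = free_act V act p v"
    and inj: "\<And>p. \<lbrakk>p \<in> algL; free_act V act p v = \<zero>\<^bsub>V\<^esub>\<rbrakk> \<Longrightarrow> frag_of (cl p, v) \<in> ker"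
  shows "lie_module_iso L V act (induced_module L (L\<lparr>carrier := S\<rparr>) (V\<lparr>carrier := E\<rparr>) act)
    (induced_act L (L\<lparr>carrier := S\<rparr>) (V\<lparr>carrier := E\<rparr>) act)"
proof (rule induced_module_iso)
  fix w assume "w \<in> carrier V"
  then obtain p where "p \<in> algL" "w = free_act V act p v"
    using gen by blast
  then show "\<exists>z\<in>carrier frags. ind_eval z = w"
    using v frag_of_frags ind_eval_frag_of by blast
next
  fix z assume z: "z \<in> carrier frags" "ind_eval z = \<zero>\<^bsub>V\<^esub>"
  have "\<exists>p\<in>algL. z - frag_of (cl p, v) \<in> ker"
    using z(1)[unfolded carrier_free_Abelian_group_iff]
  proof (induction z rule: free_Abelian_group_induct[consumes 1, case_names zero diff gen])
    case zero
    then show ?case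
      using ker_uminus[OF ker_tensor_0_left[OF v]] free_algebra_0 by (intro bexI[of _ 0]) auto
  next
    case (diff x y)
    then obtain p q where p: "p \<in> algL" "x - frag_of (cl p, v) \<in> ker"
      and q: "q \<in> algL" "y - frag_of (cl q, v) \<in> ker" by blast
    \<comment> \<open>additivity is available for sums only, hence the detour through \<open>p = (p - q) + q\<close>\<close>
    have "x - y - frag_of (cl (p - q), v) = (x - frag_of (cl p, v)) - (y - frag_of (cl q, v))
        + (frag_of (cl (p - q + q), v) - frag_of (cl (p - q), v) - frag_of (cl q, v))"
      by simp
    also have "\<dots> \<in> ker"
      using ker_add[OF ker_diff[OF p(2) q(2)]
          ker_tensor_add_left[OF free_algebra_diff[OF p(1) q(1)] q(1) v]] .
    finally show ?case
      using p q free_algebra_diff by blast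
  next
    case (gen a)
    then obtain p e where a: "a = (cl p, e)" "p \<in> algL" "e \<in> E"
      by (auto simp: L.carrier_env_alg)
    then obtain q where q: "q \<in> algS" "e = free_act V act q v"
      using cyclic by blast
    have "frag_of a - frag_of (cl (p * q), v) \<in> ker"
      using ker_uminus[OF ker_tensor_balanced[OF a(2) q(1) v]] a q by simp
    then show ?case
      using a(2) q(1) algS_algL free_algebra_mult by blast
  qed
  then obtain p where p: "p \<in> algL" "z - frag_of (cl p, v) \<in> ker" by blast
  then have "ind_eval z = ind_eval (frag_of (cl p, v))"
    using ind_eval_add[OF ker_frags[OF p(2)] frag_of_frags[OF p(1) v]] ind_eval_ker[OF p(2)]
      ind_eval_closed[OF frag_of_frags[OF p(1) v]] by simp
  then have "frag_of (cl p, v) \<in> ker"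
    using inj[OF p(1)] z(2) ind_eval_frag_of[OF p(1) v] by simp
  then show "z \<in> ker"
    using ker_add[OF p(2)] by force
qed

end


section \<open>Polynomial vector fields\<close>

definition vf :: "complex poly \<Rightarrow> der" where
  "vf f = (\<lambda>p. f * pderiv p)"

lemma vf_derivation: "vf f \<in> derivations"
  unfolding derivations_def vf_def
proof (intro CollectI conjI allI, goal_cases)
  case (1 p q)
  show ?case by (simp add: pderiv_add distrib_left)
next
  case (2 c p)
  show ?case by (simp add: pderiv_smult)
next
  case (3 p q)
  show ?case by (simp add: pderiv_mult distrib_left mult.assoc mult.left_commute)
qed

text \<open>A derivation is determined by its value at the coordinate.\<close>

lemma derivations_eq: "derivations = range vf"
proof (intro equalityI subsetI)
  fix D assume "D \<in> derivations"
  then have add: "D (p + q) = D p + D q"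
    and smult: "D (Polynomial.smult c p) = Polynomial.smult c (D p)"
    and mult: "D (p * q) = D p * q + p * D q" for p q c
    by (simp_all add: derivations_def)
  have one: "D 1 = 0"
    using mult[of 1 1] by simp
  have const: "D [:a:] = 0" for a
    using smult[of a 1] one by (simp add: one_pCons)
  have "D p = D [:0, 1:] * pderiv p" for p
  proof (induction p)
    case 0
    then show ?case using const[of 0] by simp
  next
    case (pCons a p)
    have "D (pCons a p) = D ([:a:] + [:0, 1:] * p)" by simp
    also have "\<dots> = D [:0, 1:] * p + [:0, 1:] * (D [:0, 1:] * pderiv p)"
      by (simp only: add mult const pCons.IH) simp
    finally show ?case by (simp add: pderiv_pCons algebra_simps)
  qed
  then have "D = vf (D [:0, 1:])"
    unfolding vf_def by (rule ext)
  then show "D \<in> range vf" by (rule range_eqI)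
qed (auto intro: vf_derivation)

lemma W1_simps:
  "carrier W1 = range vf" "\<zero>\<^bsub>W1\<^esub> = vf 0" "vf f \<oplus>\<^bsub>W1\<^esub> vf g = vf (f + g)"
  "c \<odot>\<^bsub>W1\<^esub> vf f = vf (Polynomial.smult c f)"
  "vf f \<otimes>\<^bsub>W1\<^esub> vf g = vf (f * pderiv g - g * pderiv f)"
  by (simp_all add: W1_def derivations_eq vf_def fun_eq_iff pderiv_mult algebra_simps)

text \<open>Everything is computed on coefficient polynomials, where the bracket of \<open>f \<partial>\<close> and \<open>g \<partial>\<close> is
\<open>(f g' - g f') \<partial>\<close> and the axioms are polynomial identities.\<close>
lemma lie_algebra_W1: "lie_algebra W1"
proof -
  have "vectorspace (class_ring :: complex ring) W1"
  proof (rule vs_criteria)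
    show "field (class_ring :: complex ring)"
      by (rule class_field.field_axioms)
    show "\<forall>v\<in>carrier W1. \<exists>neg_v\<in>carrier W1. v \<oplus>\<^bsub>W1\<^esub> neg_v = \<zero>\<^bsub>W1\<^esub>"
    proof
      fix v assume "v \<in> carrier W1"
      then obtain f where "v = vf f" by (auto simp: W1_simps)
      then show "\<exists>neg_v\<in>carrier W1. v \<oplus>\<^bsub>W1\<^esub> neg_v = \<zero>\<^bsub>W1\<^esub>"
        by (intro bexI[of _ "vf (- f)"]) (simp_all add: W1_simps)
    qed
  qed (auto simp: W1_simps smult_add_right smult_add_left add.commute add.left_commute)
  then interpret vectorspace "class_ring :: complex ring" W1 .
  show ?thesis
  proof (unfold_locales, goal_cases)
    case (1 x y)
    then show ?case by (auto simp: W1_simps)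
  next
    case (2 x y z)
    then obtain f g h where "x = vf f" "y = vf g" "z = vf h"
      by (auto simp: W1_simps)
    then show ?case
      by (simp add: W1_simps pderiv_add algebra_simps)
  next
    case (3 x y c)
    then obtain f g where "x = vf f" "y = vf g"
      by (auto simp: W1_simps)
    then show ?case
      by (simp add: W1_simps pderiv_smult smult_diff_right)
  next
    case (4 x y z)
    then obtain f g h where "x = vf f" "y = vf g" "z = vf h"
      by (auto simp: W1_simps)
    then show ?case
      by (simp add: W1_simps pderiv_add algebra_simps)
  next
    case (5 x y c)
    then obtain f g where "x = vf f" "y = vf g"
      by (auto simp: W1_simps)
    then show ?case
      by (simp add: W1_simps pderiv_smult smult_diff_right)
  next
    case (6 x)
    then obtain f where "x = vf f"
      by (auto simp: W1_simps)
    then show ?case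
      by (simp add: W1_simps)
  next
    case (7 x y z)
    then obtain f g h where "x = vf f" "y = vf g" "z = vf h"
      by (auto simp: W1_simps)
    then show ?case
      by (simp add: W1_simps pderiv_diff pderiv_mult algebra_simps)
  qed
qed

interpretation W1: lie_algebra W1
  by (rule lie_algebra_W1)

text \<open>The vector fields that vanish at the origin to order \<open>n\<close>. As \<open>t\<^sup>k\<^sup>+\<^sup>1 \<partial>\<close> has degree \<open>k\<close>, order \<open>n\<close>
corresponds to degree at least \<open>n - 1\<close>, whence the shift in \<open>W1_ge_eq\<close>.\<close>
definition vf_ord :: "nat \<Rightarrow> der set" where
  "vf_ord n = vf ` {f. \<forall>i<n. coeff f i = 0}"

lemma vf_ord_iff: "vf f \<in> vf_ord n \<longleftrightarrow> (\<forall>i<n. coeff f i = 0)"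
proof -
  have "inj vf"
  proof (rule injI)
    fix f g assume "vf f = vf g"
    then have "vf f [:0, 1:] = vf g [:0, 1:]" by simp
    then show "f = g" by (simp add: vf_def pderiv_pCons)
  qed
  then show ?thesis
    by (auto simp: vf_ord_def dest: injD)
qed

lemma submodule_vf_ord: "submodule class_ring (vf_ord n) W1"
proof (rule submodule.intro)
  show "Module.module class_ring W1"
    by (rule W1.module_axioms)
qed (auto simp: vf_ord_def W1_simps intro!: imageI)

lemma W1_comp_eq: "k \<ge> -1 \<Longrightarrow> W1_comp k = range (\<lambda>c. vf (monom c (nat (k + 1))))"
proof -
  have "Polynomial.smult c (monom 1 n * p) = monom c n * p" for c n and p :: "complex poly"
    by (metis mult_smult_left smult_monom mult.right_neutral)
  then show ?thesis
    by (auto simp: W1_comp_def vf_def image_def)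
qed

lemma W1_ge_eq: "W1_ge (int r) = W1\<lparr>carrier := vf_ord (Suc r)\<rparr>"
proof -
  let ?C = "\<Union>k\<in>{k. k \<ge> -1 \<and> k \<ge> int r}. W1_comp k"
  have "W1.span ?C = vf_ord (Suc r)"
  proof (intro equalityI)
    have "?C \<subseteq> vf_ord (Suc r)"
      by (auto simp: W1_comp_eq vf_ord_iff)
    then show "W1.span ?C \<subseteq> vf_ord (Suc r)"
      by (rule W1.span_is_subset[OF _ submodule_vf_ord])
    have sub: "?C \<subseteq> carrier W1"
      by (auto simp: W1_comp_eq W1_simps)
    interpret N: submodule class_ring "W1.span ?C" W1
      by (rule W1.span_is_submodule[OF sub])
    show "vf_ord (Suc r) \<subseteq> W1.span ?C"
    proof
      fix x assume "x \<in> vf_ord (Suc r)"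
      then obtain f where x: "x = vf f" and f: "\<forall>i<Suc r. coeff f i = 0"
        by (auto simp: vf_ord_def)
      have mon: "vf (monom (coeff f i) i) \<in> W1.span ?C" for i
      proof (cases "i < Suc r")
        case True
        then show ?thesis using f N.zero_closed by (simp add: W1_simps)
      next
        case False
        then have "vf (monom (coeff f i) i) \<in> W1_comp (int i - 1)"
          by (auto simp: W1_comp_eq)
        moreover have "int i - 1 \<in> {k. k \<ge> -1 \<and> k \<ge> int r}"
          using False by simp
        ultimately have "vf (monom (coeff f i) i) \<in> ?C"
          by (rule UN_I[rotated])
        then show ?thesis
          by (rule subsetD[OF W1.in_own_span[OF sub]])
      qed
      have "vf (\<Sum>i\<in>A. monom (coeff f i) i) \<in> W1.span ?C" if "finite A" for A
        using that
      proof (induction A rule: finite_induct)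
        case empty
        then show ?case using N.zero_closed by (simp add: W1_simps)
      next
        case (insert i A)
        then show ?case
          using N.m_closed[OF mon[of i] insert.IH] by (simp add: W1_simps)
      qed
      from this[of "{..Polynomial.degree f}"] show "x \<in> W1.span ?C"
        unfolding x poly_as_sum_of_monoms by simp
    qed
  qed
  then show ?thesis by (simp add: W1_ge_def)
qed

interpretation W1_ge0: lie_subalgebra W1 "vf_ord 1"
proof (rule lie_subalgebra.intro[OF lie_algebra_W1 lie_subalgebra_axioms.intro])
  show "submodule class_ring (vf_ord 1) W1" by (rule submodule_vf_ord)
  show "x \<otimes>\<^bsub>W1\<^esub> y \<in> vf_ord 1" if "x \<in> vf_ord 1" "y \<in> vf_ord 1" for x y
  proof -
    obtain f g where "x = vf f" "y = vf g" "coeff f 0 = 0" "coeff g 0 = 0"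
      using \<open>x \<in> vf_ord 1\<close> \<open>y \<in> vf_ord 1\<close> by (auto simp: vf_ord_def)
    then show ?thesis by (simp add: W1_simps vf_ord_iff coeff_mult_0)
  qed
qed


section \<open>The spanning half of the Poincare-Birkhoff-Witt theorem\<close>

text \<open>Membership of \<open>p\<close> in \<open>\<Sum>\<^sub>i d\<^sup>i U(S)\<close> modulo the defining ideal of \<open>U(L)\<close>.\<close>
definition (in lie_subalgebra) pbw_spanned :: "'g \<Rightarrow> ('g list \<Rightarrow>\<^sub>0 complex) \<Rightarrow> bool" where
  "pbw_spanned d p \<longleftrightarrow> (\<exists>N q. (\<forall>i. q i \<in> carrier (free_algebra S)) \<and>
     p - (\<Sum>i<N. free_gen d ^ i * q i) \<in> env_ideal L)"

context lie_subalgebra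
begin

lemma pbw_spanned_cong:
  assumes "pbw_spanned d p" "p' - p \<in> env_ideal L"
  shows "pbw_spanned d p'"
proof -
  obtain N q where "\<forall>i. q i \<in> carrier (free_algebra S)" "p - (\<Sum>i<N. free_gen d ^ i * q i) \<in> env_ideal L"
    using assms(1) unfolding pbw_spanned_def by blast
  moreover from this have "p' - (\<Sum>i<N. free_gen d ^ i * q i) \<in> env_ideal L"
    using env_ideal_add[OF assms(2)] by fastforce
  ultimately show ?thesis unfolding pbw_spanned_def by blast
qed

lemma pbw_spanned_sub: "q \<in> carrier (free_algebra S) \<Longrightarrow> pbw_spanned d q"
  unfolding pbw_spanned_def
  by (rule exI[of _ 1], rule exI[of _ "\<lambda>_. q"]) (simp add: env_ideal_0)

lemma pbw_spanned_add:
  assumes "pbw_spanned d p" "pbw_spanned d p'"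
  shows "pbw_spanned d (p + p')"
proof -
  obtain N q where q: "\<forall>i. q i \<in> carrier (free_algebra S)"
    "p - (\<Sum>i<N. free_gen d ^ i * q i) \<in> env_ideal L"
    using assms(1) unfolding pbw_spanned_def by blast
  obtain N' q' where q': "\<forall>i. q' i \<in> carrier (free_algebra S)"
    "p' - (\<Sum>i<N'. free_gen d ^ i * q' i) \<in> env_ideal L"
    using assms(2) unfolding pbw_spanned_def by blast
  let ?r = "\<lambda>i. (if i < N then q i else 0) + (if i < N' then q' i else 0)"
  \<comment> \<open>both sums are padded with zero coefficients to a common length\<close>
  have pad: "(\<Sum>i<N + N'. free_gen d ^ i * (if i < M then g i else 0)) = (\<Sum>i<M. free_gen d ^ i * g i)"
    if "M \<le> N + N'" for M and g :: "nat \<Rightarrow> 'g list \<Rightarrow>\<^sub>0 complex"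
    using that by (intro sum.mono_neutral_cong_right) auto
  have "(\<Sum>i<N + N'. free_gen d ^ i * ?r i)
      = (\<Sum>i<N. free_gen d ^ i * q i) + (\<Sum>i<N'. free_gen d ^ i * q' i)"
    using pad[of N q] pad[of N' q'] by (simp add: distrib_left sum.distrib)
  then have "(p + p') - (\<Sum>i<N + N'. free_gen d ^ i * ?r i) \<in> env_ideal L"
    using env_ideal_add[OF q(2) q'(2)] by (simp add: algebra_simps)
  moreover have "\<forall>i. ?r i \<in> carrier (free_algebra S)"
    using q(1) q'(1) by (auto intro: free_algebra_add free_algebra_0)
  ultimately show ?thesis
    unfolding pbw_spanned_def by (intro exI[of _ "N + N'"] exI[of _ ?r] conjI)
qed

lemma pbw_spanned_sum: "(\<And>i. i \<in> A \<Longrightarrow> pbw_spanned d (f i)) \<Longrightarrow> pbw_spanned d (sum f A)"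
  by (induction A rule: infinite_finite_induct)
    (auto intro: pbw_spanned_add pbw_spanned_sub free_algebra_0)

lemma pbw_spanned_const:
  assumes "pbw_spanned d p"
  shows "pbw_spanned d (free_const c * p)"
proof -
  obtain N q where q: "\<forall>i. q i \<in> carrier (free_algebra S)"
    "p - (\<Sum>i<N. free_gen d ^ i * q i) \<in> env_ideal L"
    using assms unfolding pbw_spanned_def by blast
  have "free_const c * (free_gen d ^ i * q i) = free_gen d ^ i * (free_const c * q i)" for i
    using free_const_commute[of c "free_gen d ^ i"] by (simp add: mult.assoc[symmetric])
  then have "free_const c * p - (\<Sum>i<N. free_gen d ^ i * (free_const c * q i)) \<in> env_ideal L"
    using env_ideal_lmult[OF free_algebra_const q(2), of c]
    by (simp add: right_diff_distrib sum_distrib_left)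
  moreover have "\<forall>i. free_const c * q i \<in> carrier (free_algebra S)"
    using q(1) by (auto intro: free_algebra_mult free_algebra_const)
  ultimately show ?thesis
    unfolding pbw_spanned_def by (intro exI[of _ N] exI[of _ "\<lambda>i. free_const c * q i"]) blast
qed

lemma pbw_spanned_shift:
  assumes "d \<in> carrier L" "pbw_spanned d p"
  shows "pbw_spanned d (free_gen d * p)"
proof -
  obtain N q where q: "\<forall>i. q i \<in> carrier (free_algebra S)"
    "p - (\<Sum>i<N. free_gen d ^ i * q i) \<in> env_ideal L"
    using assms(2) unfolding pbw_spanned_def by blast
  let ?q = "\<lambda>i. case i of 0 \<Rightarrow> 0 | Suc j \<Rightarrow> q j"
  have "(\<Sum>i<Suc N. free_gen d ^ i * ?q i) = free_gen d * (\<Sum>i<N. free_gen d ^ i * q i)"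
    by (simp add: sum.lessThan_Suc_shift sum_distrib_left mult.assoc del: sum.lessThan_Suc)
  then have "free_gen d * p - (\<Sum>i<Suc N. free_gen d ^ i * ?q i) \<in> env_ideal L"
    using env_ideal_lmult[OF free_algebra_gen[OF assms(1)] q(2)] by (simp only: right_diff_distrib)
  moreover have "\<forall>i. ?q i \<in> carrier (free_algebra S)"
    using q(1) by (auto intro: free_algebra_0 split: nat.split)
  ultimately show ?thesis unfolding pbw_spanned_def by blast
qed

context
  fixes d
  assumes d: "d \<in> carrier L"
    and complement: "\<And>x. x \<in> carrier L \<Longrightarrow> \<exists>c. \<exists>h\<in>S. x = c \<odot>\<^bsub>L\<^esub> d \<oplus> h"
begin

text \<open>The rule \<open>x d = d x + [x, d]\<close> moves \<open>x\<close> to the right past one factor \<open>d\<close> at a time. Both resulting terms have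
one power of \<open>d\<close> fewer to the right of a generator, namely of \<open>x\<close> or of \<open>[x, d]\<close>, which is why the induction on
the exponent is over all \<open>x\<close>. When no power of \<open>d\<close> is left, \<open>x\<close> is split along \<open>L = \<complex> d + S\<close>.\<close>
lemma pbw_spanned_gen_power:
  assumes "x \<in> carrier L" "q \<in> carrier (free_algebra S)"
  shows "pbw_spanned d (free_gen x * (free_gen d ^ i * q))"
  using assms(1)
proof (induction i arbitrary: x)
  case 0
  then obtain c h where h: "h \<in> S" "x = c \<odot>\<^bsub>L\<^esub> d \<oplus> h"
    using complement by blast
  then have hL: "h \<in> carrier L" "c \<odot>\<^bsub>L\<^esub> d \<in> carrier L"
    using sub_carrier d smult_closed[of c d] by auto
  have "free_gen x - (free_const c * free_gen d + free_gen h)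
      = (free_gen x - free_gen (c \<odot>\<^bsub>L\<^esub> d) - free_gen h)
        + (free_gen (c \<odot>\<^bsub>L\<^esub> d) - free_const c * free_gen d)"
    by simp
  also have "\<dots> \<in> env_ideal L"
    using env_ideal_add[OF env_ideal_gen_add[OF hL(2,1)] env_ideal_gen_smult[OF d, of c]]
    unfolding h(2) .
  finally have "(free_gen x - (free_const c * free_gen d + free_gen h)) * q \<in> env_ideal L"
    by (rule env_ideal_rmult[OF sub_free_algebra[OF assms(2)]])
  then have "free_gen x * q - (free_const c * (free_gen d * q) + free_gen h * q) \<in> env_ideal L"
    by (simp add: algebra_simps)
  moreover have "pbw_spanned d (free_const c * (free_gen d * q) + free_gen h * q)"
    using h(1) assms(2)
    by (intro pbw_spanned_add pbw_spanned_const pbw_spanned_shift[OF d] pbw_spanned_sub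
        free_algebra_mult free_algebra_gen)
  ultimately show ?case
    using pbw_spanned_cong by simp
next
  case (Suc i)
  let ?r = "free_gen d ^ i * q"
  have r: "?r \<in> carrier (free_algebra (carrier L))"
    using assms(2) sub_free_algebra d by (intro free_algebra_mult free_algebra_power free_algebra_gen)
  have "(free_gen x * free_gen d - free_gen d * free_gen x - free_gen (x \<otimes> d)) * ?r \<in> env_ideal L"
    by (rule env_ideal_rmult[OF r env_ideal_gen_bracket[OF Suc.prems d]])
  then have "free_gen x * (free_gen d ^ Suc i * q)
      - (free_gen d * (free_gen x * ?r) + free_gen (x \<otimes> d) * ?r) \<in> env_ideal L"
    by (simp add: algebra_simps)
  moreover have "pbw_spanned d (free_gen d * (free_gen x * ?r) + free_gen (x \<otimes> d) * ?r)"
    using Suc d by (intro pbw_spanned_add pbw_spanned_shift[OF d] Suc.IH bracket_closed)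
  ultimately show ?case
    by (rule pbw_spanned_cong[rotated])
qed

lemma pbw_spanned_gen:
  assumes x: "x \<in> carrier L" and p: "pbw_spanned d p"
  shows "pbw_spanned d (free_gen x * p)"
proof -
  obtain N q where q: "\<forall>i. q i \<in> carrier (free_algebra S)"
    "p - (\<Sum>i<N. free_gen d ^ i * q i) \<in> env_ideal L"
    using p unfolding pbw_spanned_def by blast
  have "free_gen x * p - (\<Sum>i<N. free_gen x * (free_gen d ^ i * q i)) \<in> env_ideal L"
    using env_ideal_lmult[OF free_algebra_gen[OF x] q(2)]
    by (simp add: right_diff_distrib sum_distrib_left)
  moreover have "pbw_spanned d (\<Sum>i<N. free_gen x * (free_gen d ^ i * q i))"
    using q(1) x by (intro pbw_spanned_sum pbw_spanned_gen_power) auto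
  ultimately show ?thesis
    by (rule pbw_spanned_cong[rotated])
qed

lemma pbw_spanned_all: "p \<in> carrier (free_algebra (carrier L)) \<Longrightarrow> pbw_spanned d p"
  by (induction rule: free_algebra_induct)
    (auto intro: pbw_spanned_sub pbw_spanned_gen pbw_spanned_add free_algebra_const)

end

end


section \<open>Eigenvectors\<close>

text \<open>The value \<open>p(x)\<close> in the free algebra, by Horner's scheme.\<close>
definition free_poly :: "'g \<Rightarrow> complex poly \<Rightarrow> 'g list \<Rightarrow>\<^sub>0 complex" where
  "free_poly x p = fold_coeffs (\<lambda>a r. free_const a + free_gen x * r) p 0"

lemma free_poly_0: "free_poly x 0 = 0"
  by (simp add: free_poly_def)

lemma free_poly_pCons: "free_poly x (pCons a p) = free_const a + free_gen x * free_poly x p"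
proof (cases "p = 0")
  case True
  then show ?thesis
    by (cases "a = 0") (simp_all add: free_poly_def free_const_0)
next
  case False
  then show ?thesis by (simp add: free_poly_def)
qed

lemma free_poly_1: "free_poly x 1 = 1"
  by (simp add: one_pCons free_poly_pCons free_poly_0 free_const_1)

lemma free_poly_add: "free_poly x (p + q) = free_poly x p + free_poly x q"
  by (induction p q rule: poly_induct2)
    (simp_all add: free_poly_0 free_poly_pCons free_const_add algebra_simps)

lemma free_poly_smult: "free_poly x (Polynomial.smult c p) = free_const c * free_poly x p"
proof (induction p)
  case (pCons a p)
  then show ?case
    using free_const_commute[of c "free_gen x"]
    by (simp add: free_poly_pCons free_const_mult distrib_left flip: mult.assoc)
qed (simp add: free_poly_0)

lemma free_poly_mult: "free_poly x (p * q) = free_poly x p * free_poly x q"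
  by (induction p)
    (simp_all add: free_poly_0 free_poly_pCons free_poly_add free_poly_smult free_const_0
      algebra_simps)

lemma free_poly_closed: "x \<in> S \<Longrightarrow> free_poly x p \<in> carrier (free_algebra S)"
  by (induction p) (auto simp: free_poly_0 free_poly_pCons intro!: free_algebra_closed)

text \<open>If a nonzero polynomial in \<open>x\<close> kills \<open>v\<close>, split off a linear factor \<open>x - a\<close>. Either \<open>x - a\<close> kills \<open>v\<close>, and
\<open>v\<close> is an eigenvector, or the cofactor kills the nonzero vector \<open>(x - a) v\<close>. The eigenvector found is again a
polynomial in \<open>x\<close> applied to \<open>v\<close>, so that it stays in every subspace stable under \<open>x\<close> that contains \<open>v\<close>.\<close>
lemma free_act_free_poly_root:
  assumes V: "lie_module L V act" and x: "x \<in> carrier L" and "p \<noteq> 0"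
    and "v \<in> carrier V" "v \<noteq> \<zero>\<^bsub>V\<^esub>" "free_act V act (free_poly x p) v = \<zero>\<^bsub>V\<^esub>"
  shows "\<exists>q a. free_act V act (free_poly x q) v \<noteq> \<zero>\<^bsub>V\<^esub> \<and>
    act x (free_act V act (free_poly x q) v) = a \<odot>\<^bsub>V\<^esub> free_act V act (free_poly x q) v"
  using assms(3-)
proof (induction "Polynomial.degree p" arbitrary: p v rule: less_induct)
  case less
  interpret V: lie_module L V act by (rule V)
  let ?f = "\<lambda>p. free_act V act (free_poly x p)"
  have closed: "free_poly x p \<in> carrier (free_algebra (carrier L))" for p
    by (rule free_poly_closed[OF x])
  show ?case
  proof (cases "Polynomial.degree p = 0")
    case True
    then obtain c where c: "p = [:c:]"
      by (metis degree_eq_zeroE)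
    with less.prems have "c \<odot>\<^bsub>V\<^esub> v = \<zero>\<^bsub>V\<^esub>" "c \<noteq> 0"
      by (auto simp: free_poly_pCons free_poly_0 V.free_act_const)
    then have "inverse c \<odot>\<^bsub>V\<^esub> (c \<odot>\<^bsub>V\<^esub> v) = \<zero>\<^bsub>V\<^esub>"
      using V.V.smult_r_null by simp
    moreover have "(inverse c * c) \<odot>\<^bsub>V\<^esub> v = inverse c \<odot>\<^bsub>V\<^esub> (c \<odot>\<^bsub>V\<^esub> v)"
      using V.V.smult_assoc1[of "inverse c" c v] less.prems(2) by simp
    ultimately have "v = \<zero>\<^bsub>V\<^esub>"
      using V.V.smult_one[OF less.prems(2)] \<open>c \<noteq> 0\<close> by simp
    then show ?thesis using less.prems by simp
  next
    case False
    then have "\<not> constant (poly p)"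
      by (simp add: constant_degree)
    then obtain a where "poly p a = 0"
      using fundamental_theorem_of_algebra by blast
    then obtain r where r: "p = [:- a, 1:] * r"
      by (auto simp: poly_eq_0_iff_dvd elim: dvdE)
    then have r0: "r \<noteq> 0"
      using less.prems(1) by auto
    then have deg: "Polynomial.degree r < Polynomial.degree p"
      using degree_mult_eq[of "[:- a, 1:]" r] by (simp add: r)
    define w where "w = ?f [:- a, 1:] v"
    have w: "w \<in> carrier V"
      unfolding w_def by (rule V.free_act_closed[OF closed less.prems(2)])
    have comp: "?f q w = ?f (q * [:- a, 1:]) v" for q
      by (simp only: w_def free_poly_mult V.free_act_mult[OF closed closed less.prems(2)])
    show ?thesis
    proof (cases "w = \<zero>\<^bsub>V\<^esub>")
      case True
      have av: "a \<odot>\<^bsub>V\<^esub> v \<in> carrier V" "(- a) \<odot>\<^bsub>V\<^esub> v \<in> carrier V" "act x v \<in> carrier V"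
        using V.V.smult_closed[of a v] V.V.smult_closed[of "- a" v] V.act_closed[OF x] less.prems(2)
        by simp_all
      have w_eq: "w = (- a) \<odot>\<^bsub>V\<^esub> v \<oplus>\<^bsub>V\<^esub> act x v"
        using less.prems(2) x
        by (simp add: w_def free_poly_pCons free_poly_0 free_const_0 free_const_1
            V.free_act_add_left V.free_act_const V.free_act_gen free_algebra_const free_algebra_gen)
      have "(a \<odot>\<^bsub>V\<^esub> v) \<oplus>\<^bsub>V\<^esub> ((- a) \<odot>\<^bsub>V\<^esub> v) = \<zero>\<^bsub>V\<^esub>"
        using V.V.smult_l_distr[of a "- a" v] V.V.lmult_0[of v] less.prems(2) by simp
      then have "act x v = a \<odot>\<^bsub>V\<^esub> v \<oplus>\<^bsub>V\<^esub> w"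
        unfolding w_eq using av by (simp add: V.V.a_assoc[symmetric])
      also have "\<dots> = a \<odot>\<^bsub>V\<^esub> v"
        unfolding True using av by simp
      finally have "act x v = a \<odot>\<^bsub>V\<^esub> v" .
      then show ?thesis
        using less.prems(2,3) by (intro exI[of _ 1] exI[of _ a]) (simp add: free_poly_1 V.free_act_1)
    next
      case False
      have "?f r w = \<zero>\<^bsub>V\<^esub>"
        using less.prems(4) by (simp add: comp r mult.commute[of r])
      from less.hyps[OF deg r0 w False this] show ?thesis
        unfolding comp by blast
    qed
  qed
qed


section \<open>Modules of height one\<close>

locale height_one_module = lie_module W1 V act
  for V :: "(complex, 'v) module" (structure) and act :: "der \<Rightarrow> 'v \<Rightarrow> 'v" +
  assumes simple: "simple_lie_module W1 V act"
    and smooth: "smooth_module V act"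
    and height: "height V act = 1"
begin

lemma vf_carrier: "vf f \<in> carrier W1"
  by (simp add: W1_simps)

lemma act_vf_0: "v \<in> carrier V \<Longrightarrow> act (vf 0) v = \<zero>\<^bsub>V\<^esub>"
  using act_smult_left[of "vf 0" v 0] V.lmult_0[of "act (vf 0) v"] act_closed[of "vf 0" v]
  by (simp add: W1_simps)

lemma act_vf_add:
  "v \<in> carrier V \<Longrightarrow> act (vf (f + g)) v = act (vf f) v \<oplus>\<^bsub>V\<^esub> act (vf g) v"
  using act_add_left[of "vf f" "vf g" v] by (simp add: W1_simps)

lemma act_vf_smult:
  "v \<in> carrier V \<Longrightarrow> act (vf (Polynomial.smult c f)) v = c \<odot>\<^bsub>V\<^esub> act (vf f) v"
  using act_smult_left[of "vf f" v c] by (simp add: W1_simps)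

lemma inv_space_iff:
  "v \<in> inv_space V act r \<longleftrightarrow>
    v \<in> carrier V \<and> (\<forall>f. (\<forall>i\<le>r. coeff f i = 0) \<longrightarrow> act (vf f) v = \<zero>\<^bsub>V\<^esub>)"
  by (auto simp: inv_space_def W1_ge_eq vf_ord_def less_Suc_eq_le)

text \<open>Some \<open>V\<^sup>(\<^sup>r\<^sup>)\<close> is nonzero, so that the minimum in the definition of the height is attained.\<close>

lemma inv_space_smooth:
  assumes "v \<in> carrier V"
  shows "\<exists>r. v \<in> inv_space V act r"
proof -
  obtain m :: nat where m: "\<And>i x. \<lbrakk>i \<ge> int m; x \<in> W1_comp i\<rbrakk> \<Longrightarrow> act x v = \<zero>\<^bsub>V\<^esub>"
    using smooth assms unfolding smooth_module_def by blast
  have "act (vf f) v = \<zero>\<^bsub>V\<^esub>" if f: "\<forall>i\<le>m. coeff f i = 0" for f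
  proof -
    have mon: "act (vf (monom (coeff f i) i)) v = \<zero>\<^bsub>V\<^esub>" for i
    proof (cases "i \<le> m")
      case True
      then show ?thesis using f assms by (simp add: act_vf_0)
    next
      case False
      then have "vf (monom (coeff f i) i) \<in> W1_comp (int i - 1)"
        by (auto simp: W1_comp_eq)
      then show ?thesis
        using False m[of "int i - 1"] by simp
    qed
    have "act (vf (\<Sum>i\<in>A. monom (coeff f i) i)) v = \<zero>\<^bsub>V\<^esub>" if "finite A" for A
      using that
    proof (induction A rule: finite_induct)
      case empty
      then show ?case using assms by (simp add: act_vf_0)
    next
      case (insert i A)
      then show ?case using assms mon[of i] by (simp add: act_vf_add)
    qed
    from this[of "{..Polynomial.degree f}"] show ?thesis
      unfolding poly_as_sum_of_monoms by simp
  qed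
  then show ?thesis
    using assms by (auto simp: inv_space_iff)
qed

abbreviation "E \<equiv> inv_space V act 1"
abbreviation "euler \<equiv> vf [:0, 1:]"
abbreviation "partial \<equiv> vf 1"

lemma E_closed: "e \<in> E \<Longrightarrow> e \<in> carrier V"
  by (simp add: inv_space_iff)

lemma zero_in_inv_space: "\<zero>\<^bsub>V\<^esub> \<in> inv_space V act r"
  using act_0_right[OF vf_carrier] by (simp add: inv_space_iff)

lemma inv_space_height: "inv_space V act 0 = {\<zero>\<^bsub>V\<^esub>}" "E \<noteq> {\<zero>\<^bsub>V\<^esub>}"
proof -
  let ?P = "\<lambda>r. inv_space V act r \<noteq> {\<zero>\<^bsub>V\<^esub>}"
  have "carrier V \<noteq> {\<zero>\<^bsub>V\<^esub>}"
    using simple by (simp add: simple_lie_module_def)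
  then obtain v where "v \<in> carrier V" "v \<noteq> \<zero>\<^bsub>V\<^esub>"
    using V.zero_closed by blast
  then obtain r where "?P r"
    using inv_space_smooth by blast
  moreover have L: "(LEAST r. ?P r) = 1"
    using height by (simp only: height_def)
  ultimately show "E \<noteq> {\<zero>\<^bsub>V\<^esub>}"
    using LeastI[of ?P r] by simp
  show "inv_space V act 0 = {\<zero>\<^bsub>V\<^esub>}"
    using not_less_Least[of 0 ?P] L by simp
qed

text \<open>A field that vanishes at the origin differs from a multiple of the Euler field by one of order two, and these
kill \<open>E\<close>.\<close>
lemma act_E:
  assumes "e \<in> E" "coeff f 0 = 0"
  shows "act (vf f) e = coeff f 1 \<odot>\<^bsub>V\<^esub> act euler e"
proof -
  have e: "e \<in> carrier V" by (rule E_closed[OF assms(1)])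
  \<comment> \<open>the part of order two\<close>
  let ?g = "f - Polynomial.smult (coeff f 1) [:0, 1:]"
  have "coeff ?g i = 0" if "i \<le> 1" for i
    using that assms(2) by (cases i) auto
  then have "act (vf ?g) e = \<zero>\<^bsub>V\<^esub>"
    using assms(1) unfolding inv_space_iff by blast
  moreover have "act (vf (Polynomial.smult (coeff f 1) [:0, 1:] + ?g)) e
      = coeff f 1 \<odot>\<^bsub>V\<^esub> act euler e \<oplus>\<^bsub>V\<^esub> act (vf ?g) e"
    by (simp only: act_vf_add[OF e] act_vf_smult[OF e])
  ultimately show ?thesis
    using act_closed[OF vf_carrier e] V.smult_closed[of "coeff f 1" "act euler e"] by simp
qed

text \<open>Such an \<open>e\<close> is killed by all fields vanishing at the origin, hence lies in \<open>V\<^sup>(\<^sup>0\<^sup>)\<close>.\<close>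
lemma act_euler_0_imp_0:
  assumes "e \<in> E" "act euler e = \<zero>\<^bsub>V\<^esub>"
  shows "e = \<zero>\<^bsub>V\<^esub>"
proof -
  have "e \<in> inv_space V act 0"
    using act_E[OF assms(1)] assms E_closed[OF assms(1)] by (simp add: inv_space_iff V.smult_r_null)
  then show ?thesis using inv_space_height(1) by simp
qed

lemma submodule_E: "submodule class_ring E V"
proof (rule submodule.intro)
  show "Module.module class_ring V" by (rule V.module_axioms)
  show "E \<subseteq> carrier V" using E_closed by blast
  show "\<zero>\<^bsub>V\<^esub> \<in> E" by (rule zero_in_inv_space)
  show "u \<oplus>\<^bsub>V\<^esub> v \<in> E" if "u \<in> E" "v \<in> E" for u v
    using that by (simp add: inv_space_iff act_add_right[OF vf_carrier])
  show "c \<odot>\<^bsub>V\<^esub> v \<in> E" if "v \<in> E" for c v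
    using that V.smult_closed[of c v] V.smult_r_null[of c]
    by (simp add: inv_space_iff act_smult_right[OF vf_carrier])
qed

text \<open>Fields of order two form an ideal among the fields of order one.\<close>
lemma stable_E:
  assumes "x \<in> vf_ord 1" "e \<in> E"
  shows "act x e \<in> E"
proof -
  obtain f where x: "x = vf f" and f: "coeff f 0 = 0"
    using assms(1) by (auto simp: vf_ord_def)
  have e: "e \<in> carrier V" by (rule E_closed[OF assms(2)])
  have "act (vf g) (act x e) = \<zero>\<^bsub>V\<^esub>" if g: "\<forall>i\<le>1. coeff g i = 0" for g
  proof -
    let ?h = "g * pderiv f - f * pderiv g"
    have g01: "coeff g 0 = 0" "coeff g 1 = 0" using g by auto
    have "\<forall>i\<le>1. coeff ?h i = 0"
    proof (intro allI impI)
      fix i :: nat assume "i \<le> 1"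
      then consider "i = 0" | "i = 1" by linarith
      then show "coeff ?h i = 0"
        using g01 f by cases (simp_all add: coeff_mult coeff_pderiv)
    qed
    then have "act (vf ?h) e = \<zero>\<^bsub>V\<^esub>" "act (vf g) e = \<zero>\<^bsub>V\<^esub>"
      using assms(2) g unfolding inv_space_iff by blast+
    then have "act (vf g) (act x e) \<ominus>\<^bsub>V\<^esub> \<zero>\<^bsub>V\<^esub> = \<zero>\<^bsub>V\<^esub>"
      using act_bracket[OF vf_carrier vf_carrier e, of g f] act_0_right[OF vf_carrier]
      by (simp add: W1_simps x)
    moreover have "\<ominus>\<^bsub>V\<^esub> \<zero>\<^bsub>V\<^esub> = \<zero>\<^bsub>V\<^esub>"
      by (rule V.minus_equality) simp_all
    ultimately show ?thesis
      using act_closed[OF vf_carrier act_closed[OF vf_carrier e], of g f]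
      by (simp add: x a_minus_def)
  qed
  then show ?thesis
    using act_closed[OF vf_carrier e] by (simp add: inv_space_iff x)
qed

sublocale ind: lie_induction W1 V act "vf_ord 1" E
  by (rule lie_induction.intro[OF lie_module_axioms W1_ge0.lie_subalgebra_axioms
      lie_induction_axioms.intro[OF submodule_E stable_E]])

abbreviation "\<delta> \<equiv> free_gen partial"

lemma \<delta>_closed: "\<delta> ^ i \<in> ind.algL"
  by (intro free_algebra_power free_algebra_gen vf_carrier)

lemma free_act_\<delta>_Suc:
  "v \<in> carrier V \<Longrightarrow> free_act V act (\<delta> ^ Suc i) v = act partial (free_act V act (\<delta> ^ i) v)"
  using free_act_gen_mult[OF \<delta>_closed vf_carrier] by simp

text \<open>Commuting \<open>d\<^sub>k\<close> past one factor \<open>\<partial>\<close> produces \<open>[d\<^sub>k, \<partial>] = -(k + 1) d\<^sub>k\<^sub>-\<^sub>1\<close>, while \<open>d\<^sub>k\<close> itself, once past the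
remaining powers, has become a multiple of some \<open>d\<^sub>j\<close> with \<open>j > 0\<close>, which kills \<open>w\<close>. Hence \<open>i\<close> factors
\<open>\<partial>\<close> lower the index by \<open>i\<close>, with a nonzero product of integers as coefficient.\<close>
lemma lower_power:
  assumes "i \<le> k"
  shows "\<exists>c. c \<noteq> 0 \<and> (\<forall>w\<in>E. act (vf (monom 1 (Suc k))) (free_act V act (\<delta> ^ i) w)
    = c \<odot>\<^bsub>V\<^esub> act (vf (monom 1 (Suc (k - i)))) w)"
  using assms
proof (induction i arbitrary: k)
  case 0
  have "act (vf (monom 1 (Suc k))) (free_act V act 1 w) = 1 \<odot>\<^bsub>V\<^esub> act (vf (monom 1 (Suc k))) w"
    if "w \<in> E" for w
    using E_closed[OF that] V.smult_one[of "act (vf (monom 1 (Suc k))) w"] act_closed[OF vf_carrier]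
    by (simp add: free_act_1)
  then show ?case by (intro exI[of _ 1]) simp
next
  case (Suc i)
  then obtain j where k: "k = Suc j" "i \<le> j"
    by (cases k) auto
  obtain c where c: "\<And>w. w \<in> E \<Longrightarrow> act (vf (monom 1 (Suc k))) (free_act V act (\<delta> ^ i) w)
    = c \<odot>\<^bsub>V\<^esub> act (vf (monom 1 (Suc (k - i)))) w"
    using Suc.IH[of k] Suc.prems by auto
  obtain c' where c': "c' \<noteq> 0" "\<And>w. w \<in> E \<Longrightarrow> act (vf (monom 1 (Suc j))) (free_act V act (\<delta> ^ i) w)
    = c' \<odot>\<^bsub>V\<^esub> act (vf (monom 1 (Suc (j - i)))) w"
    using Suc.IH[of j] k by auto
  let ?b = "- of_nat (Suc k) :: complex"
  have "act (vf (monom 1 (Suc k))) (free_act V act (\<delta> ^ Suc i) w)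
      = (?b * c') \<odot>\<^bsub>V\<^esub> act (vf (monom 1 (Suc (k - Suc i)))) w" if w: "w \<in> E" for w
  proof -
    have wV: "w \<in> carrier V" by (rule E_closed[OF w])
    define u where "u = free_act V act (\<delta> ^ i) w"
    have u: "u \<in> carrier V"
      unfolding u_def by (rule free_act_closed[OF \<delta>_closed wV])
    have "\<forall>l\<le>1. coeff (monom (1 :: complex) (Suc (k - i))) l = 0"
      using k by auto
    then have "act (vf (monom 1 (Suc (k - i)))) w = \<zero>\<^bsub>V\<^esub>"
      using w unfolding inv_space_iff by blast
    then have 1: "act (vf (monom 1 (Suc k))) u = \<zero>\<^bsub>V\<^esub>"
      using c[OF w] V.smult_r_null[of c] by (simp add: u_def)
    \<comment> \<open>\<open>[d\<^sub>k, \<partial>] = -(k + 1) d\<^sub>k\<^sub>-\<^sub>1\<close>\<close>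
    have br: "vf (monom 1 (Suc k)) \<otimes>\<^bsub>W1\<^esub> partial = vf (Polynomial.smult ?b (monom 1 (Suc j)))"
      by (simp add: W1_simps pderiv_monom smult_monom k minus_monom)
    have "act (vf (Polynomial.smult ?b (monom 1 (Suc j)))) u
        = act (vf (monom 1 (Suc k))) (act partial u) \<ominus>\<^bsub>V\<^esub> act partial \<zero>\<^bsub>V\<^esub>"
      using act_bracket[OF vf_carrier vf_carrier u, of "monom 1 (Suc k)" 1] by (simp only: br 1)
    then have "act (vf (monom 1 (Suc k))) (act partial u)
        = ?b \<odot>\<^bsub>V\<^esub> act (vf (monom 1 (Suc j))) u"
      using act_0_right[OF vf_carrier] act_closed[OF vf_carrier act_closed[OF vf_carrier u]]
      by (simp add: act_vf_smult[OF u] a_minus_def)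
    also have "\<dots> = ?b \<odot>\<^bsub>V\<^esub> (c' \<odot>\<^bsub>V\<^esub> act (vf (monom 1 (Suc (j - i)))) w)"
      using c'(2)[OF w] by (simp add: u_def)
    also have "\<dots> = (?b * c') \<odot>\<^bsub>V\<^esub> act (vf (monom 1 (Suc (k - Suc i)))) w"
      using V.smult_assoc1[of ?b c' "act (vf (monom 1 (Suc (j - i)))) w"]
        act_closed[OF vf_carrier wV] k by simp
    finally show ?thesis
      by (simp only: free_act_\<delta>_Suc[OF wV] u_def)
  qed
  moreover have "?b * c' \<noteq> 0"
    using c'(1) by (simp del: of_nat_Suc)
  ultimately show ?case by blast
qed

lemma act_power_vanish:
  assumes "i < k" "w \<in> E"
  shows "act (vf (monom 1 (Suc k))) (free_act V act (\<delta> ^ i) w) = \<zero>\<^bsub>V\<^esub>"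
proof -
  obtain c where "act (vf (monom 1 (Suc k))) (free_act V act (\<delta> ^ i) w)
      = c \<odot>\<^bsub>V\<^esub> act (vf (monom 1 (Suc (k - i)))) w"
    using lower_power[of i k] assms by auto
  moreover have "\<forall>l\<le>1. coeff (monom (1 :: complex) (Suc (k - i))) l = 0"
    using assms(1) by auto
  then have "act (vf (monom 1 (Suc (k - i)))) w = \<zero>\<^bsub>V\<^esub>"
    using assms(2) unfolding inv_space_iff by blast
  ultimately show ?thesis
    using V.smult_r_null[of c] by simp
qed

lemma act_power_inj:
  assumes "w \<in> E" "act (vf (monom 1 (Suc k))) (free_act V act (\<delta> ^ k) w) = \<zero>\<^bsub>V\<^esub>"
  shows "w = \<zero>\<^bsub>V\<^esub>"
proof -
  obtain c where c: "c \<noteq> 0" "act (vf (monom 1 (Suc k))) (free_act V act (\<delta> ^ k) w)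
      = c \<odot>\<^bsub>V\<^esub> act (vf (monom 1 (Suc 0))) w"
    using lower_power[of k k] assms(1) by auto
  have "monom (1 :: complex) (Suc 0) = [:0, 1:]"
    by (simp add: monom_Suc)
  with c assms(2) have "c \<odot>\<^bsub>V\<^esub> act euler w = \<zero>\<^bsub>V\<^esub>" by simp
  then have "c \<odot>\<^bsub>V\<^esub> w' = \<zero>\<^bsub>V\<^esub> \<Longrightarrow> w' \<in> carrier V \<Longrightarrow> w' = \<zero>\<^bsub>V\<^esub>" for w'
    using c(1) V.smult_assoc1[of "inverse c" c w'] V.smult_r_null[of "inverse c"] V.smult_one[of w']
    by simp
  then have "act euler w = \<zero>\<^bsub>V\<^esub>"
    using \<open>c \<odot>\<^bsub>V\<^esub> act euler w = \<zero>\<^bsub>V\<^esub>\<close> act_closed[OF vf_carrier E_closed[OF assms(1)]] by blast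
  then show ?thesis
    by (rule act_euler_0_imp_0[OF assms(1)])
qed

lemma power_sum_closed:
  "\<forall>i. q i \<in> ind.algS \<Longrightarrow> (\<Sum>i<N. \<delta> ^ i * q i) \<in> ind.algL"
  by (intro free_algebra_sum free_algebra_mult \<delta>_closed) (simp add: ind.algS_algL)

lemma free_act_power_sum_Suc:
  assumes "\<forall>i. q i \<in> ind.algS" "w \<in> E"
  shows "free_act V act (\<Sum>i<Suc N. \<delta> ^ i * q i) w =
    free_act V act (\<Sum>i<N. \<delta> ^ i * q i) w \<oplus>\<^bsub>V\<^esub> free_act V act (\<delta> ^ N) (free_act V act (q N) w)"
  using assms E_closed[OF assms(2)] ind.algS_algL \<delta>_closed
  by (simp add: free_act_add_left[OF power_sum_closed free_algebra_mult] free_act_mult)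

lemma act_power_sum_vanish:
  assumes q: "\<forall>i. q i \<in> ind.algS" and w: "w \<in> E" and "N \<le> k"
  shows "act (vf (monom 1 (Suc k))) (free_act V act (\<Sum>i<N. \<delta> ^ i * q i) w) = \<zero>\<^bsub>V\<^esub>"
  using assms(3)
proof (induction N)
  case 0
  then show ?case
    using E_closed[OF w] act_0_right[OF vf_carrier] by (simp add: free_act_0)
next
  case (Suc N)
  have qE: "free_act V act (q N) w \<in> E"
    using q w ind.free_act_stable by blast
  have "act (vf (monom 1 (Suc k))) (free_act V act (\<delta> ^ N) (free_act V act (q N) w)) = \<zero>\<^bsub>V\<^esub>"
    using Suc.prems by (intro act_power_vanish qE) simp
  then show ?case
    using Suc free_act_closed[OF power_sum_closed[OF q] E_closed[OF w]]
      free_act_closed[OF \<delta>_closed E_closed[OF qE]]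
    by (simp add: free_act_power_sum_Suc[OF q w] act_add_right[OF vf_carrier] del: sum.lessThan_Suc)
qed

text \<open>Independence of the powers of \<open>\<partial>\<close> over \<open>E\<close>. As \<open>d\<^sub>N\<close> with \<open>N > 0\<close> kills \<open>E\<close> as well as all lower
powers, it kills the top term of the sum too, and there it acts as a nonzero multiple of \<open>d\<^sub>0\<close>. The top
coefficient therefore vanishes, and induction on \<open>N\<close> applies.\<close>
lemma power_sum_in_E:
  assumes q: "\<forall>i. q i \<in> ind.algS" and w: "w \<in> E"
    and "free_act V act (\<Sum>i<Suc N. \<delta> ^ i * q i) w \<in> E"
  shows "(\<forall>i\<in>{1..N}. free_act V act (q i) w = \<zero>\<^bsub>V\<^esub>) \<and>
    free_act V act (\<Sum>i<Suc N. \<delta> ^ i * q i) w = free_act V act (q 0) w"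
  using assms(3)
proof (induction N)
  case 0
  then show ?case by simp
next
  case (Suc N)
  let ?D = "vf (monom 1 (Suc (Suc N)))"
  let ?y = "free_act V act (\<Sum>i<Suc N. \<delta> ^ i * q i) w"
  have qE: "free_act V act (q (Suc N)) w \<in> E"
    using q w ind.free_act_stable by blast
  have y: "?y \<in> carrier V"
    by (rule free_act_closed[OF power_sum_closed[OF q] E_closed[OF w]])
  have z: "free_act V act (\<delta> ^ Suc N) (free_act V act (q (Suc N)) w) \<in> carrier V"
    by (rule free_act_closed[OF \<delta>_closed E_closed[OF qE]])
  note split = free_act_power_sum_Suc[OF q w, of "Suc N"]
  have "\<forall>l\<le>1. coeff (monom (1 :: complex) (Suc (Suc N))) l = 0"
    by auto
  then have "act ?D (free_act V act (\<Sum>i<Suc (Suc N). \<delta> ^ i * q i) w) = \<zero>\<^bsub>V\<^esub>"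
    using Suc.prems unfolding inv_space_iff by blast
  then have "act ?D ?y \<oplus>\<^bsub>V\<^esub> act ?D (free_act V act (\<delta> ^ Suc N) (free_act V act (q (Suc N)) w)) = \<zero>\<^bsub>V\<^esub>"
    unfolding split act_add_right[OF vf_carrier y z] .
  then have "act ?D (free_act V act (\<delta> ^ Suc N) (free_act V act (q (Suc N)) w)) = \<zero>\<^bsub>V\<^esub>"
    unfolding act_power_sum_vanish[OF q w order_refl] using act_closed[OF vf_carrier z] by simp
  then have 0: "free_act V act (q (Suc N)) w = \<zero>\<^bsub>V\<^esub>"
    by (rule act_power_inj[OF qE])
  have eq: "free_act V act (\<Sum>i<Suc (Suc N). \<delta> ^ i * q i) w = ?y"
    unfolding split 0 free_act_0_right[OF \<delta>_closed] by (rule V.r_zero[OF y])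
  have "?y \<in> E"
    using Suc.prems unfolding eq .
  from Suc.IH[OF this] 0 eq show ?case
    by (auto simp: atLeastAtMostSuc_conv simp del: sum.lessThan_Suc)
qed

lemma generated:
  assumes v: "v \<in> carrier V" "v \<noteq> \<zero>\<^bsub>V\<^esub>" and w: "w \<in> carrier V"
  shows "\<exists>p\<in>ind.algL. w = free_act V act p v"
proof -
  let ?W = "(\<lambda>p. free_act V act p v) ` ind.algL"
  have "lie_submodule W1 V act ?W"
    unfolding lie_submodule_def
  proof (intro conjI ballI)
    show "submodule class_ring ?W V"
    proof (rule submodule.intro)
      show "Module.module class_ring V" by (rule V.module_axioms)
      show "?W \<subseteq> carrier V" using free_act_closed v(1) by blast
      show "\<zero>\<^bsub>V\<^esub> \<in> ?W"
        using free_act_0[OF v(1)] free_algebra_0 by (intro image_eqI[of _ _ 0]) auto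
      show "a \<oplus>\<^bsub>V\<^esub> b \<in> ?W" if ab: "a \<in> ?W" "b \<in> ?W" for a b
      proof -
        obtain p q where "p \<in> ind.algL" "a = free_act V act p v" "q \<in> ind.algL" "b = free_act V act q v"
          using ab by blast
        then show ?thesis
          using free_act_add_left[of p q v] v(1) by (intro image_eqI[of _ _ "p + q"] free_algebra_add) auto
      qed
      show "c \<odot>\<^bsub>V\<^esub> a \<in> ?W" if a: "a \<in> ?W" for c a
      proof -
        obtain p where "p \<in> ind.algL" "a = free_act V act p v"
          using a by blast
        then show ?thesis
          using free_act_const_mult[of p v c] v(1)
          by (intro image_eqI[of _ _ "free_const c * p"] free_algebra_mult free_algebra_const) auto
      qed
    qed
    show "act x a \<in> ?W" if x: "x \<in> carrier W1" and a: "a \<in> ?W" for x a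
    proof -
      obtain p where "p \<in> ind.algL" "a = free_act V act p v"
        using a by blast
      then show ?thesis
        using free_act_gen_mult[of p x v] v(1) x
        by (intro image_eqI[of _ _ "free_gen x * p"] free_algebra_mult free_algebra_gen) auto
    qed
  qed
  then have "?W = {\<zero>\<^bsub>V\<^esub>} \<or> ?W = carrier V"
    using simple unfolding simple_lie_module_def by blast
  moreover have "v \<in> ?W"
    using free_act_1[OF v(1)] free_algebra_1 by (intro image_eqI[of _ _ 1]) auto
  ultimately show ?thesis using v(2) w by auto
qed

text \<open>A field splits as \<open>f \<partial> = f(0) \<partial> + (f - f(0)) \<partial>\<close>, so \<open>\<partial>\<close> spans a complement of the fields of order one. The sum
is written with at least one summand to match \<open>power_sum_in_E\<close>.\<close>
lemma pbw:
  assumes "p \<in> ind.algL"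
  shows "\<exists>N q. (\<forall>i. q i \<in> ind.algS) \<and> p - (\<Sum>i<Suc N. \<delta> ^ i * q i) \<in> env_ideal W1"
proof -
  have "\<exists>c. \<exists>h\<in>vf_ord 1. x = c \<odot>\<^bsub>W1\<^esub> partial \<oplus>\<^bsub>W1\<^esub> h" if x: "x \<in> carrier W1" for x
  proof -
    obtain f where x: "x = vf f" using x by (auto simp: W1_simps)
    have "x = coeff f 0 \<odot>\<^bsub>W1\<^esub> partial \<oplus>\<^bsub>W1\<^esub> vf (f - [:coeff f 0:])"
      by (simp add: x W1_simps)
    moreover have "vf (f - [:coeff f 0:]) \<in> vf_ord 1"
      by (simp add: vf_ord_iff)
    ultimately show ?thesis by blast
  qed
  then have "W1_ge0.pbw_spanned partial p"
    by (rule W1_ge0.pbw_spanned_all[OF vf_carrier _ assms])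
  then obtain N q where q: "\<forall>i. q i \<in> ind.algS" "p - (\<Sum>i<N. \<delta> ^ i * q i) \<in> env_ideal W1"
    unfolding W1_ge0.pbw_spanned_def by blast
  let ?q = "\<lambda>i. if i < N then q i else 0"
  have "(\<Sum>i<Suc N. \<delta> ^ i * ?q i) = (\<Sum>i<N. \<delta> ^ i * q i)"
    by simp
  moreover have "\<forall>i. ?q i \<in> ind.algS"
    using q(1) free_algebra_0[of "vf_ord 1"] by simp
  ultimately show ?thesis
    using q(2) by (intro exI[of _ N] exI[of _ ?q]) simp
qed

text \<open>\<open>E\<close> is simple over the fields of order one: writing \<open>e = p v\<close> with \<open>p = \<Sum>\<^sub>i \<partial>\<^sup>i q\<^sub>i\<close>, only the term with
\<open>i = 0\<close> survives, since \<open>e\<close> lies in \<open>E\<close>.\<close>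
lemma E_cyclic:
  assumes v: "v \<in> E" "v \<noteq> \<zero>\<^bsub>V\<^esub>" and e: "e \<in> E"
  shows "\<exists>q\<in>ind.algS. e = free_act V act q v"
proof -
  obtain p where p: "p \<in> ind.algL" "e = free_act V act p v"
    using generated[OF E_closed[OF v(1)] v(2) E_closed[OF e]] by blast
  obtain N q where q: "\<forall>i. q i \<in> ind.algS" "p - (\<Sum>i<Suc N. \<delta> ^ i * q i) \<in> env_ideal W1"
    using pbw[OF p(1)] by blast
  have "e = free_act V act (\<Sum>i<Suc N. \<delta> ^ i * q i) v"
    unfolding p(2) by (rule free_act_cong[OF p(1) power_sum_closed[OF q(1)] q(2) E_closed[OF v(1)]])
  then have "e = free_act V act (q 0) v"
    using power_sum_in_E[OF q(1) v(1), of N] e by simp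
  then show ?thesis using q(1) by blast
qed

text \<open>On \<open>E\<close> each field of order one is a multiple of the Euler field, so words act as its powers.\<close>
lemma algS_poly:
  assumes "q \<in> ind.algS"
  shows "\<exists>p. \<forall>e\<in>E. free_act V act q e = free_act V act (free_poly euler p) e"
  using assms
proof (induction rule: free_algebra_induct)
  case (const c)
  show ?case
    by (rule exI[of _ "[:c:]"]) (simp add: free_poly_pCons free_poly_0)
next
  case (gen x q)
  then obtain p where p: "\<And>e. e \<in> E \<Longrightarrow> free_act V act q e = free_act V act (free_poly euler p) e"
    by blast
  obtain f where x: "x = vf f" and f: "coeff f 0 = 0"
    using gen(1) by (auto simp: vf_ord_def)
  have "free_act V act (free_gen x * q) e
      = free_act V act (free_poly euler (Polynomial.smult (coeff f 1) (pCons 0 p))) e" if e: "e \<in> E" for e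
  proof -
    have eV: "e \<in> carrier V" by (rule E_closed[OF e])
    have "free_act V act (free_gen x * q) e = act x (free_act V act q e)"
      using free_act_gen_mult[OF ind.algS_algL[OF gen(2)] vf_carrier eV] by (simp add: x)
    also have "\<dots> = coeff f 1 \<odot>\<^bsub>V\<^esub> act euler (free_act V act q e)"
      unfolding x by (rule act_E[OF ind.free_act_stable[OF gen(2) e] f])
    also have "\<dots> = coeff f 1 \<odot>\<^bsub>V\<^esub> act euler (free_act V act (free_poly euler p) e)"
      by (simp only: p[OF e])
    also have "\<dots> = free_act V act (free_poly euler (Polynomial.smult (coeff f 1) (pCons 0 p))) e"
      unfolding free_poly_smult free_poly_pCons free_const_0 add_0_left
      using eV free_poly_closed[OF vf_carrier] vf_carrier
      by (simp add: free_act_const_mult free_act_gen_mult free_algebra_closed)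
    finally show ?thesis .
  qed
  then show ?case by blast
next
  case (add q q')
  then obtain p p' where "\<And>e. e \<in> E \<Longrightarrow> free_act V act q e = free_act V act (free_poly euler p) e"
    "\<And>e. e \<in> E \<Longrightarrow> free_act V act q' e = free_act V act (free_poly euler p') e"
    by blast
  then have "\<forall>e\<in>E. free_act V act (q + q') e = free_act V act (free_poly euler (p + p')) e"
    using add(1,2) ind.algS_algL E_closed free_poly_closed[OF vf_carrier]
    by (simp add: free_poly_add free_act_add_left)
  then show ?case by blast
qed

text \<open>Cyclicity applied to \<open>d\<^sub>0 e\<close> gives \<open>e = p(d\<^sub>0) d\<^sub>0 e\<close>. The polynomial \<open>p X - 1\<close> then kills \<open>e\<close>, and it is
nonzero because its value at \<open>0\<close> is \<open>-1\<close>.\<close>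
lemma E_eigenvector:
  "\<exists>v\<in>E. v \<noteq> \<zero>\<^bsub>V\<^esub> \<and> (\<exists>a. act euler v = a \<odot>\<^bsub>V\<^esub> v)"
proof -
  obtain e where e: "e \<in> E" "e \<noteq> \<zero>\<^bsub>V\<^esub>"
    using inv_space_height(2) zero_in_inv_space[of 1] by blast
  have eV: "e \<in> carrier V" by (rule E_closed[OF e(1)])
  have euler: "euler \<in> vf_ord 1" by (simp add: vf_ord_iff)
  have u: "act euler e \<in> E" "act euler e \<noteq> \<zero>\<^bsub>V\<^esub>"
    using stable_E[OF euler e(1)] act_euler_0_imp_0[OF e(1)] e(2) by auto
  obtain q where q: "q \<in> ind.algS" "e = free_act V act q (act euler e)"
    using E_cyclic[OF u e(1)] by blast
  obtain p where p: "\<And>e. e \<in> E \<Longrightarrow> free_act V act q e = free_act V act (free_poly euler p) e"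
    using algS_poly[OF q(1)] by blast
  let ?r = "p * [:0, 1:] - 1"
  have cl: "free_poly euler f \<in> ind.algL" for f
    by (rule free_poly_closed[OF vf_carrier])
  have X: "free_act V act (free_poly euler [:0, 1:]) e = act euler e"
    using eV by (simp add: free_poly_pCons free_poly_0 free_const_0 free_const_1 free_act_gen vf_carrier)
  have "free_act V act (free_poly euler (p * [:0, 1:])) e = e"
    using q(2) unfolding free_poly_mult free_act_mult[OF cl cl eV] X p[OF u(1)] by simp
  moreover have "free_act V act (free_poly euler (p * [:0, 1:])) e
      = free_act V act (free_poly euler ?r) e \<oplus>\<^bsub>V\<^esub> e"
  proof -
    have "free_poly euler (p * [:0, 1:]) = free_poly euler ?r + 1"
      using free_poly_add[of euler ?r 1] by (simp add: free_poly_1)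
    then show ?thesis
      by (simp only: free_act_add_left[OF cl free_algebra_1 eV] free_act_1[OF eV])
  qed
  ultimately have "free_act V act (free_poly euler ?r) e = \<zero>\<^bsub>V\<^esub>"
    using V.add.right_cancel[of e "free_act V act (free_poly euler ?r) e" "\<zero>\<^bsub>V\<^esub>"]
      eV free_act_closed[OF cl[of ?r] eV] by simp
  moreover have "?r \<noteq> 0"
  proof
    assume "?r = 0"
    then have "poly ?r 0 = poly 0 0" by metis
    then show False by simp
  qed
  ultimately obtain f a where "free_act V act (free_poly euler f) e \<noteq> \<zero>\<^bsub>V\<^esub>"
    "act euler (free_act V act (free_poly euler f) e) = a \<odot>\<^bsub>V\<^esub> free_act V act (free_poly euler f) e"
    using free_act_free_poly_root[OF lie_module_axioms vf_carrier _ eV e(2)] by blast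
  moreover have "free_act V act (free_poly euler f) e \<in> E"
    by (rule ind.free_act_stable[OF free_poly_closed[OF euler] e(1)])
  ultimately show ?thesis by blast
qed

text \<open>The line through an eigenvector is stable, and each nonzero vector of \<open>E\<close> generates \<open>E\<close>.\<close>
lemma E_line:
  assumes v: "v \<in> E" "v \<noteq> \<zero>\<^bsub>V\<^esub>" "act euler v = a \<odot>\<^bsub>V\<^esub> v" and e: "e \<in> E"
  shows "\<exists>c. e = c \<odot>\<^bsub>V\<^esub> v"
proof -
  have vV: "v \<in> carrier V" by (rule E_closed[OF v(1)])
  have "\<exists>c. free_act V act q v = c \<odot>\<^bsub>V\<^esub> v" if "q \<in> ind.algS" for q
    using that
  proof (induction rule: free_algebra_induct)
    case (const c)
    show ?case using vV by (auto simp: free_act_const)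
  next
    case (gen x q)
    then obtain c where c: "free_act V act q v = c \<odot>\<^bsub>V\<^esub> v" by blast
    obtain f where x: "x = vf f" and f: "coeff f 0 = 0"
      using gen(1) by (auto simp: vf_ord_def)
    have "free_act V act (free_gen x * q) v = act x (c \<odot>\<^bsub>V\<^esub> v)"
      using free_act_gen_mult[OF ind.algS_algL[OF gen(2)] vf_carrier vV] by (simp add: x c)
    also have "\<dots> = c \<odot>\<^bsub>V\<^esub> (coeff f 1 \<odot>\<^bsub>V\<^esub> (a \<odot>\<^bsub>V\<^esub> v))"
      unfolding x act_smult_right[OF vf_carrier vV] act_E[OF v(1) f] v(3) ..
    also have "\<dots> = (c * (coeff f 1 * a)) \<odot>\<^bsub>V\<^esub> v"
      using V.smult_assoc1[of "coeff f 1" a v] V.smult_assoc1[of c "coeff f 1 * a" v] vV by simp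
    finally show ?case by blast
  next
    case (add q q')
    then obtain c c' where "free_act V act q v = c \<odot>\<^bsub>V\<^esub> v" "free_act V act q' v = c' \<odot>\<^bsub>V\<^esub> v"
      by blast
    then have "free_act V act (q + q') v = (c + c') \<odot>\<^bsub>V\<^esub> v"
      using free_act_add_left[OF ind.algS_algL[OF add(1)] ind.algS_algL[OF add(2)] vV]
        V.smult_l_distr[of c c' v] vV by simp
    then show ?case by blast
  qed
  then show ?thesis
    using E_cyclic[OF v(1,2) e] by metis
qed

theorem nontrivial_E: "\<not> trivial_lie_module (W1\<lparr>carrier := vf_ord 1\<rparr>) (V\<lparr>carrier := E\<rparr>) act"
proof
  assume "trivial_lie_module (W1\<lparr>carrier := vf_ord 1\<rparr>) (V\<lparr>carrier := E\<rparr>) act"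
  moreover have "euler \<in> vf_ord 1" by (simp add: vf_ord_iff)
  ultimately have "e = \<zero>\<^bsub>V\<^esub>" if "e \<in> E" for e
    using act_euler_0_imp_0[OF that] that by (simp add: trivial_lie_module_def)
  then show False
    using inv_space_height(2) zero_in_inv_space[of 1] by blast
qed

theorem dim_E:
  "vectorspace.fin_dim class_ring (V\<lparr>carrier := E\<rparr>) \<and> vectorspace.dim class_ring (V\<lparr>carrier := E\<rparr>) = 1"
proof -
  obtain v a where v: "v \<in> E" "v \<noteq> \<zero>\<^bsub>V\<^esub>" "act euler v = a \<odot>\<^bsub>V\<^esub> v"
    using E_eigenvector by blast
  interpret E: vectorspace class_ring "V\<lparr>carrier := E\<rparr>"
    by (rule V.subspace_is_vs[OF subspace.intro[OF V.vectorspace_axioms submodule_E]])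
  have "E.span {v} = E"
  proof
    show "E.span {v} \<subseteq> E"
      using E.span_is_subset2[of "{v}"] v(1) by simp
    show "E \<subseteq> E.span {v}"
    proof
      fix e assume "e \<in> E"
      then obtain c where "e = c \<odot>\<^bsub>V\<^esub> v" using E_line[OF v] by blast
      moreover have "c \<odot>\<^bsub>V\<^esub> v \<in> E.span {v}"
        using submodule.smult_closed[OF E.span_is_submodule[of "{v}"], of c v]
          E.in_own_span[of "{v}"] v(1) by simp
      ultimately show "e \<in> E.span {v}" by simp
    qed
  qed
  then have span: "E.span {v} = carrier (V\<lparr>carrier := E\<rparr>)" by simp
  have "E.fin_dim"
    unfolding E.fin_dim_def using span v(1) by (intro exI[of _ "{v}"]) simp
  moreover have "E.dim = 1"
    using E.dim1I[OF span] v by simp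
  ultimately show ?thesis ..
qed

theorem induced_E:
  "lie_module_iso W1 V act
     (induced_module W1 (W1\<lparr>carrier := vf_ord 1\<rparr>) (V\<lparr>carrier := E\<rparr>) act)
     (induced_act W1 (W1\<lparr>carrier := vf_ord 1\<rparr>) (V\<lparr>carrier := E\<rparr>) act)"
proof -
  obtain v where v: "v \<in> E" "v \<noteq> \<zero>\<^bsub>V\<^esub>"
    using inv_space_height(2) zero_in_inv_space[of 1] by blast
  have vV: "v \<in> carrier V" by (rule E_closed[OF v(1)])
  show ?thesis
  proof (rule ind.induced_module_iso_cyclic[OF v(1)])
    show "\<exists>q\<in>ind.algS. e = free_act V act q v" if "e \<in> E" for e
      by (rule E_cyclic[OF v that])
    show "\<exists>p\<in>ind.algL. w = free_act V act p v" if "w \<in> carrier V" for w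
      by (rule generated[OF vV v(2) that])
    show "frag_of (ind.cl p, v) \<in> ind.ker" if p: "p \<in> ind.algL" "free_act V act p v = \<zero>\<^bsub>V\<^esub>" for p
    proof -
      obtain N q where q: "\<forall>i. q i \<in> ind.algS" "p - (\<Sum>i<Suc N. \<delta> ^ i * q i) \<in> env_ideal W1"
        using pbw[OF p(1)] by blast
      have sum0: "free_act V act (\<Sum>i<Suc N. \<delta> ^ i * q i) v = \<zero>\<^bsub>V\<^esub>"
        using free_act_cong[OF p(1) power_sum_closed[OF q(1)] q(2) vV] p(2) by simp
      then have "(\<forall>i\<in>{1..N}. free_act V act (q i) v = \<zero>\<^bsub>V\<^esub>) \<and> free_act V act (q 0) v = \<zero>\<^bsub>V\<^esub>"
        using power_sum_in_E[OF q(1) v(1), of N] zero_in_inv_space[of 1] by simp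
      then have q0: "free_act V act (q i) v = \<zero>\<^bsub>V\<^esub>" if "i < Suc N" for i
        using that by (cases i) auto
      have "frag_of (ind.cl (\<Sum>i<Suc N. \<delta> ^ i * q i), v) \<in> ind.ker"
        using q(1) q0 v(1) \<delta>_closed ind.algS_algL
        by (intro ind.ker_tensor_sum ind.ker_tensor_annihilated free_algebra_mult) auto
      moreover have "ind.cl p = ind.cl (\<Sum>i<Suc N. \<delta> ^ i * q i)"
        using q(2) W1.env_class_eq_iff by blast
      ultimately show ?thesis by simp
    qed
  qed
qed

end

theorem lemma4p9:
  fixes V :: "(complex, 'v) module" and act :: "der \<Rightarrow> 'v \<Rightarrow> 'v"
  assumes simple: "simple_lie_module W1 V act"
    and nontrivial: "\<not> trivial_lie_module W1 V act"
    and smooth: "smooth_module V act"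
    and height: "height V act = 1"
  shows "let E = inv_module V act (height V act) in
         \<not> trivial_lie_module (W1_ge 0) E act \<and>
         vectorspace.fin_dim class_ring E \<and> vectorspace.dim class_ring E = 1 \<and>
         lie_module_iso W1 V act
           (induced_module W1 (W1_ge 0) E act) (induced_act W1 (W1_ge 0) E act)"
proof -
  interpret height_one_module V act
    using simple smooth height
    by (intro height_one_module.intro height_one_module_axioms.intro)
      (simp_all add: simple_lie_module_def)
  have W: "W1_ge 0 = W1\<lparr>carrier := vf_ord 1\<rparr>"
    using W1_ge_eq[of 0] by simp
  have I: "inv_module V act (height V act) = V\<lparr>carrier := E\<rparr>"
    unfolding height inv_module_def ..
  show ?thesis
    unfolding Let_def W I using nontrivial_E dim_E induced_E by blast
qed

end
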